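(* Let $\tilde{\mathcal{C}}^b$ be the set of bounded Knuth biwords and $\tilde{\mathcal{T}}^b$ the set of pairs $(P,Q)$ of RSSYT of the same partition shape such that $K_+(P)\ge K_-(Q)$. Then the value-reversed version of column insertion RSK yields a bijection $\tilde{\mathcal{C}}^b\to\tilde{\mathcal{T}}^b$.
   Context: A Knuth biword is a pair of words $(a,i)$ of positive integers of the same length such that $i$ is weakly decreasing and $i_j=i_{j+1}$ implies $a_j\le a_{j+1}$. It is bounded if $i_j\le a_j$ for all $j$. A reverse semistandard Young tableau (RSSYT) of partition shape (English notation) has positive integer entries weakly decreasing along rows (left to right) and strictly decreasing down columns. $\mathrm{word}(T)$ reads the columns from left to right, each from bottom to top. Value-reversed column insertion RSK: start with empty tableaux and, for $j=1,2,\dots$, column insert $a_j$ into $P$ and record $i_j$ in $Q$ in the newly created box. To insert $x$ into a column of an RSSYT: if $x$ is less than all entries of the column (or the column is empty), append $x$ at the bottom and stop; otherwise replace the largest entry $y\le x$ of the column by $x$ and insert $y$ into the next column to the right. The map sends $(a,i)$ to $(P,Q)$. Keys of RSSYT (these compute the classical Lascoux–Schützenberger keys adapted to RSSYT); columns are identified with sets. Right key: for $S\subseteq\mathbb{Z}_{>0}$, $m\in\mathbb{Z}_{>0}$, let $m'$ be the smallest element of $S$ with $m'\ge m$; $S\star m=(S\setminus\{m'\})\cup\{m\}$ if $m'$ exists, else $S\star m=S\cup\{m\}$; for a word, $S\star w_1\cdots w_n=(\cdots(S\star w_1)\star\cdots)\star w_n$. $K_+(P)$ is the key tableau whose $j$-th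 column is $\emptyset\star\mathrm{word}(P_{\ge j})$, where $P_{\ge j}$ is $P$ with its first $j-1$ columns removed. Left key: if $C_1C_2$ are adjacent columns of an RSSYT and $C_2=\{a_1<\dots<a_m\}$, let $b_1$ be the smallest element of $C_1$ with $b_1\ge a_1$, and recursively $b_j$ the smallest element of $C_1$ with $b_j\ge a_j$ and $b_j>b_{j-1}$; put $C_1\triangleleft C_2=\{b_1<\dots<b_m\}$ and $C_1\triangleleft\cdots\triangleleft C_k=C_1\triangleleft(C_2\triangleleft\cdots\triangleleft C_k)$. $K_-(Q)$ is the key tableau whose $k$-th column is $C_1\triangleleft\cdots\triangleleft C_k$, where $C_1,C_2,\dots$ are the columns of $Q$. For key tableaux of the same shape, $\ge$ is entrywise comparison (comparing the $r$-th smallest elements of corresponding columns). *)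

theory Defs
  imports Main
begin

text \<open>
  Positive integers are natural numbers with an explicit positivity condition. A tableau in
  English notation is the list of its nonempty columns from left to right, each column being
  listed from top to bottom, so entry \<open>T ! c ! r\<close> sits in row \<open>r\<close> and column \<open>c\<close>.
\<close>

type_synonym tableau = "nat list list"

definition shape :: "tableau \<Rightarrow> nat list" where
  "shape T = map length T"
  \<comment> \<open>the column lengths, i.e. the conjugate of the partition given by the row lengths\<close>

definition rssyt :: "tableau \<Rightarrow> bool" where
  "rssyt T \<longleftrightarrow>
     [] \<notin> set T \<and> sorted_wrt (\<ge>) (shape T) \<and>
     (\<forall>C \<in> set T. (\<forall>x \<in> set C. 0 < x) \<and> sorted_wrt (>) C) \<and>
     (\<forall>c r. Suc c < length T \<longrightarrow> r < length (T ! Suc c) \<longrightarrow> T ! c ! r \<ge> T ! Suc c ! r)"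

definition knuth_biword :: "nat list \<times> nat list \<Rightarrow> bool" where
  "knuth_biword = (\<lambda>(a, i).
     length a = length i \<and> (\<forall>x \<in> set a. 0 < x) \<and> (\<forall>x \<in> set i. 0 < x) \<and>
     sorted_wrt (\<ge>) i \<and>
     (\<forall>j. Suc j < length i \<longrightarrow> i ! j = i ! Suc j \<longrightarrow> a ! j \<le> a ! Suc j))"

definition bounded_biword :: "nat list \<times> nat list \<Rightarrow> bool" where
  "bounded_biword = (\<lambda>(a, i). \<forall>j < length i. i ! j \<le> a ! j)"


subsection \<open>Value-reversed column insertion\<close>

text \<open>Returns the new tableau and the index of the column containing the new box.\<close>

fun column_insert :: "nat \<Rightarrow> tableau \<Rightarrow> tableau \<times> nat" where
  "column_insert x [] = ([[x]], 0)"
| "column_insert x (C # Cs) =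
     (if \<forall>y \<in> set C. x < y then ((C @ [x]) # Cs, 0)
      else let y = Max {y \<in> set C. y \<le> x}; (Cs', c) = column_insert y Cs
           in (map (\<lambda>z. if z = y then x else z) C # Cs', Suc c))"

definition append_to_column :: "nat \<Rightarrow> nat \<Rightarrow> tableau \<Rightarrow> tableau" where
  "append_to_column c k Q = (if c < length Q then Q[c := Q ! c @ [k]] else Q @ [[k]])"

definition rsk_step :: "tableau \<times> tableau \<Rightarrow> nat \<times> nat \<Rightarrow> tableau \<times> tableau" where
  "rsk_step = (\<lambda>(P, Q) (x, k).
     let (P', c) = column_insert x P in (P', append_to_column c k Q))"

definition rsk :: "nat list \<times> nat list \<Rightarrow> tableau \<times> tableau" where
  "rsk = (\<lambda>(a, i). foldl rsk_step ([], []) (zip a i))"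


subsection \<open>Keys\<close>

definition column_of_set :: "nat set \<Rightarrow> nat list" where
  "column_of_set S = rev (sorted_list_of_set S)"

definition word :: "tableau \<Rightarrow> nat list" where
  "word T = concat (map rev T)"

definition star :: "nat set \<Rightarrow> nat \<Rightarrow> nat set" where
  "star S m = (if \<exists>s \<in> S. m \<le> s then insert m (S - {LEAST s. s \<in> S \<and> m \<le> s}) else insert m S)"

definition right_key :: "tableau \<Rightarrow> tableau" where
  "right_key P = map (\<lambda>j. column_of_set (foldl star {} (word (drop j P)))) [0..<length P]"

text \<open>
  For \<open>as\<close> the increasing list of \<open>a\<^sub>1 < \<dots> < a\<^sub>m\<close>, the list of \<open>b\<^sub>1 < \<dots> < b\<^sub>m\<close>; the condition
  \<open>b\<^sub>j > b\<^sub>j\<^sub>-\<^sub>1\<close> is imposed by shrinking the set from which the later entries are chosen. The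
  \<open>LEAST\<close> always exists for the columns of a reverse semistandard tableau.
\<close>

fun greedy_match :: "nat set \<Rightarrow> nat list \<Rightarrow> nat list" where
  "greedy_match C [] = []"
| "greedy_match C (a # as) =
     (let b = (LEAST b. b \<in> C \<and> a \<le> b) in b # greedy_match {c \<in> C. b < c} as)"

definition ltri :: "nat set \<Rightarrow> nat set \<Rightarrow> nat set" where
  "ltri C\<^sub>1 C\<^sub>2 = set (greedy_match C\<^sub>1 (sorted_list_of_set C\<^sub>2))"

fun ltri_columns :: "tableau \<Rightarrow> nat set" where
  "ltri_columns [] = {}"
| "ltri_columns [C] = set C"
| "ltri_columns (C # D # Cs) = ltri (set C) (ltri_columns (D # Cs))"

definition left_key :: "tableau \<Rightarrow> tableau" where
  "left_key Q = map (\<lambda>k. column_of_set (ltri_columns (take (Suc k) Q))) [0..<length Q]"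

text \<open>
  Entrywise comparison; it requires equal shapes. As columns are strictly decreasing, comparing
  them position by position is comparing their \<open>r\<close>-th smallest elements.
\<close>

definition tableau_ge :: "tableau \<Rightarrow> tableau \<Rightarrow> bool" where
  "tableau_ge = list_all2 (list_all2 (\<ge>))"


definition bounded_knuth_biwords :: "(nat list \<times> nat list) set" where
  "bounded_knuth_biwords = {w. knuth_biword w \<and> bounded_biword w}"

definition key_bounded_pairs :: "(tableau \<times> tableau) set" where
  "key_bounded_pairs =
     {(P, Q). rssyt P \<and> rssyt Q \<and> shape P = shape Q \<and> tableau_ge (right_key P) (left_key Q)}"

end

theory Submission
  imports Defs
begin

text \<open>
  Append one letter \<open>(x, k)\<close> to a Knuth biword and let \<open>c\<close> be the column of the new box. Both keys keep
  all their columns except column \<open>c\<close>, which gains one element: \<open>R\<^sub>c\<close> becomes \<open>R\<^sub>c \<union> {t}\<close> and \<open>L\<^sub>c\<close> becomes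
  \<open>L\<^sub>c \<union> {s}\<close>. For the right key this holds because \<open>\<star>\<close> is monotone in the set, respects the Knuth
  relations, and preserves column lengths. For the left key it is the exchange property of greedy
  matching. The new elements are extremal: every element of \<open>R\<^sub>c\<close> below \<open>t\<close> lies in \<open>R\<^sub>c\<^sub>+\<^sub>1\<close>, and every
  element of \<open>L\<^sub>c\<^sub>-\<^sub>1\<close> below \<open>s\<close> lies in \<open>L\<^sub>c\<close> (with \<open>s = k\<close> and \<open>x \<le> t\<close> in the first column). Comparing
  the numbers of elements below each value then gives that the new keys satisfy \<open>R \<ge> L\<close> if and only if
  the old ones do and \<open>k \<le> x\<close>, so the key condition is equivalent to boundedness by induction.
\<close>

text \<open>Bijectivity is a separate matter from the keys: all Knuth biwords correspond to all
  pairs of RSSYT of equal shape, and because the key condition is equivalent to boundedness, this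
  bijection restricts on both sides. It is inverted one letter at a time, starting from the
  rightmost column of \<open>Q\<close> that contains its smallest entry. The obstacle in the key
  step is that outside the first column no inequality between \<open>t\<close> and \<open>s\<close>
  is available, so column \<open>c\<close> cannot be compared by itself. For the values at which the
  two counts might change differently, the comparison makes a detour through a neighbouring column,
  which the step leaves unchanged: column \<open>c + 1\<close> when passing from the new keys to the
  old ones, column \<open>c - 1\<close> in the other direction. The two extremality statements are
  what makes these detours possible.\<close>

subsection \<open>Dominance of finite sets\<close>

text \<open>A counting form of entrywise comparison: for strictly decreasing lists it says that the
  list of \<open>B\<close> is no longer than that of \<open>A\<close> and lies entrywise below it
  (\<open>dominates_iff_nth\<close>). One relation thus serves as shape condition, row condition and
  key inequality. Counts change by at most 1 when an element enters or leaves, whereas positions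
  shift.\<close>

definition dominates :: "nat set \<Rightarrow> nat set \<Rightarrow> bool" where
  "dominates A B \<longleftrightarrow> (\<forall>v. card {b \<in> B. v \<le> b} \<le> card {a \<in> A. v \<le> a})"

lemma card_Collect_insert:
  assumes "finite A" "a \<notin> A"
  shows "card {b \<in> insert a A. P b} = (if P a then 1 else 0) + card {b \<in> A. P b}"
proof -
  have "{b \<in> insert a A. P b} = (if P a then insert a {b \<in> A. P b} else {b \<in> A. P b})" by auto
  then show ?thesis using assms by auto
qed

lemma card_Collect_remove:
  assumes "finite A" "a \<in> A"
  shows "card {b \<in> A. P b} = (if P a then 1 else 0) + card {b \<in> A - {a}. P b}"
  using card_Collect_insert[of "A - {a}" a P] assms by (simp add: insert_absorb)

lemma dominates_trans: "dominates A B \<Longrightarrow> dominates B C \<Longrightarrow> dominates A C"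
  unfolding dominates_def by (meson order_trans)

lemma dominates_superset:
  assumes "finite A" "B \<subseteq> A"
  shows "dominates A B"
  unfolding dominates_def using assms by (auto intro!: card_mono)

lemma dominates_empty [simp]: "dominates A {}"
  by (simp add: dominates_def)

lemma dominatesD_ex:
  assumes "dominates A B" "finite B" "b \<in> B"
  shows "\<exists>a\<in>A. b \<le> a"
proof -
  have "card {c \<in> B. b \<le> c} > 0" using assms by (auto simp: card_gt_0_iff)
  then have "card {a \<in> A. b \<le> a} > 0" using assms unfolding dominates_def by (meson order_less_le_trans)
  then show ?thesis by (auto simp: card_gt_0_iff)
qed

lemma card_split_less:
  assumes "finite (A :: nat set)"
  shows "card {a \<in> A. v \<le> a} + card {a \<in> A. a < v} = card A"
proof -
  have "A = {a \<in> A. v \<le> a} \<union> {a \<in> A. a < v}" by auto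
  moreover have "card ({a \<in> A. v \<le> a} \<union> {a \<in> A. a < v}) = card {a \<in> A. v \<le> a} + card {a \<in> A. a < v}"
    using assms by (intro card_Un_disjoint) auto
  ultimately show ?thesis by simp
qed

text \<open>Complements turn counts from above into counts from below. The key step needs the
  latter, since what is known about the new key elements concerns the elements smaller than they
  are.\<close>

lemma dominates_iff_less:
  assumes "finite A" "finite B" "card A = card B"
  shows "dominates A B \<longleftrightarrow> (\<forall>v. card {a \<in> A. a < v} \<le> card {b \<in> B. b < v})"
proof -
  have "card {b \<in> B. v \<le> b} \<le> card {a \<in> A. v \<le> a} \<longleftrightarrow> card {a \<in> A. a < v} \<le> card {b \<in> B. b < v}" for v
    using card_split_less[OF assms(1), of v] card_split_less[OF assms(2), of v] assms(3) by linarith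
  then show ?thesis unfolding dominates_def by blast
qed

text \<open>Maxima can be peeled off: the count for \<open>B\<close> vanishes at every
  \<open>v > y\<close>, and at \<open>v <= y\<close> both sides lose exactly one.\<close>

lemma dominates_insert_insert:
  assumes "finite A" "finite B" "\<forall>a\<in>A. a < x" "\<forall>b\<in>B. b < y"
  shows "dominates (insert x A) (insert y B) \<longleftrightarrow> y \<le> x \<and> dominates A B"
proof -
  have nm: "x \<notin> A" "y \<notin> B" using assms by auto
  have xs: "card {a \<in> insert x A. v \<le> a} = (if v \<le> x then 1 else 0) + card {a \<in> A. v \<le> a}" for v
    using card_Collect_insert[OF assms(1) nm(1)] .
  have ys: "card {a \<in> insert y B. v \<le> a} = (if v \<le> y then 1 else 0) + card {a \<in> B. v \<le> a}" for v
    using card_Collect_insert[OF assms(2) nm(2)] .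
  have z: "v > y \<Longrightarrow> card {b \<in> B. v \<le> b} = 0" for v using assms(2,4) by fastforce
  show ?thesis
  proof
    assume d: "dominates (insert x A) (insert y B)"
    have yx: "y \<le> x"
      using dominatesD_ex[OF d, of y] assms by force
    have "card {b \<in> B. v \<le> b} \<le> card {a \<in> A. v \<le> a}" for v
      using d[unfolded dominates_def, rule_format, of v] xs[of v] ys[of v] z[of v] yx
      by (cases "v \<le> y") auto
    then show "y \<le> x \<and> dominates A B" using yx unfolding dominates_def by blast
  next
    assume "y \<le> x \<and> dominates A B"
    then show "dominates (insert x A) (insert y B)"
      unfolding dominates_def xs ys by (fastforce intro: le_SucI)
  qed
qed

lemma dominates_iff_nth:
  assumes "sorted_wrt (>) xs" "sorted_wrt (>) ys"
  shows "dominates (set xs) (set ys) \<longleftrightarrow> length ys \<le> length xs \<and> (\<forall>r < length ys. ys ! r \<le> xs ! r)"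
  using assms
proof (induction xs ys rule: list_induct2')
  case (3 y ys)
  then show ?case using dominatesD_ex[of "{}" "set (y # ys)" y] by auto
next
  case (4 x xs y ys)
  then show ?case
    using dominates_insert_insert[of "set xs" "set ys" x y] by (auto simp: All_less_Suc2)
qed auto

subsection \<open>The star action\<close>

text \<open>An element at or above \<open>m\<close> survives unless it is the least such, i.e. iff a
  smaller candidate exists. This eliminates \<open>LEAST\<close>, and since \<open>S\<close> occurs
  only positively, monotonicity becomes immediate.\<close>

lemma in_star_iff:
  "e \<in> star S m \<longleftrightarrow> e = m \<or> e \<in> S \<and> (e < m \<or> (\<exists>t\<in>S. m \<le> t \<and> t < e))"
proof (cases "\<exists>s\<in>S. m \<le> s")
  case True
  define l where "l = (LEAST s. s \<in> S \<and> m \<le> s)"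
  have l: "l \<in> S" "m \<le> l" using True LeastI_ex[of "\<lambda>s. s \<in> S \<and> m \<le> s"] unfolding l_def by auto
  have least: "l \<le> s" if "s \<in> S" "m \<le> s" for s using that unfolding l_def by (simp add: Least_le)
  have "star S m = insert m (S - {l})" using True by (simp add: star_def l_def)
  then show ?thesis using l least by (auto; meson leI le_antisym less_le_trans order.strict_iff_order) 
next
  case False
  then show ?thesis by (auto simp: star_def not_le)
qed

lemma star_mono: "S \<subseteq> S' \<Longrightarrow> star S m \<subseteq> star S' m"
  by (auto simp: in_star_iff subset_iff)

lemma foldl_star_mono: "S \<subseteq> S' \<Longrightarrow> foldl star S w \<subseteq> foldl star S' w"
  by (induction w arbitrary: S S') (auto simp: star_mono)

lemma finite_star [simp]: "finite S \<Longrightarrow> finite (star S m)"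
  by (simp add: star_def)

lemma finite_foldl_star [simp]: "finite S \<Longrightarrow> finite (foldl star S w)"
  by (induction w arbitrary: S) auto

text \<open>A letter displaces only an element at least as large as itself and then joins the set,
  so the minimum never rises.\<close>

lemma foldl_star_lower:
  assumes "(\<exists>e\<in>S. e \<le> m) \<or> m \<in> set w"
  shows "\<exists>e\<in>foldl star S w. e \<le> m"
  using assms
proof (induction w arbitrary: S)
  case (Cons n w)
  have "(\<exists>e\<in>star S n. e \<le> m) \<or> m \<in> set w"
  proof -
    have "\<exists>e'\<in>star S n. e' \<le> m" if "e \<in> S" "e \<le> m" for e
      using that by (cases "e < n") (auto simp: in_star_iff intro: bexI[of _ e] bexI[of _ n])
    then show ?thesis using Cons.prems by (auto simp: in_star_iff)
  qed
  then show ?case using Cons.IH by simp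
qed auto

lemma foldl_star_keep_less:
  "x \<in> S \<Longrightarrow> \<forall>m\<in>set w. x < m \<Longrightarrow> x \<in> foldl star S w"
  by (induction w arbitrary: S) (auto simp: in_star_iff)

lemma foldl_star_above:
  assumes "sorted_wrt (<) w" "\<forall>s\<in>S. \<forall>m\<in>set w. s < m"
  shows "foldl star S w = S \<union> set w"
  using assms
proof (induction w arbitrary: S)
  case (Cons m w)
  have "star S m = insert m S" using Cons.prems by (auto simp: in_star_iff)
  then show ?case using Cons by auto
qed simp

text \<open>Only the counts for \<open>d < v <= l\<close> drop. There \<open>S\<close> has no
  element between \<open>d\<close> and \<open>v\<close>, so the hypothesis at \<open>d\<close>,
  which counts \<open>d\<close> as well, pays for the element lost.\<close>

lemma star_dominates:
  assumes "finite S" "finite D" "dominates S (insert d D)" "\<forall>e\<in>D. d < e"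
  shows "card (star S d) = card S" "dominates (star S d) D"
proof -
  define l where "l = (LEAST s. s \<in> S \<and> d \<le> s)"
  have ex: "\<exists>s\<in>S. d \<le> s" using dominatesD_ex[OF assms(3)] assms by auto
  have l: "l \<in> S" "d \<le> l" using ex LeastI_ex[of "\<lambda>s. s \<in> S \<and> d \<le> s"] unfolding l_def by auto
  have least: "l \<le> s" if "s \<in> S" "d \<le> s" for s using that unfolding l_def by (simp add: Least_le)
  have st: "star S d = insert d (S - {l})" using ex by (simp add: star_def l_def)
  have dn: "d \<notin> S - {l}" using least[of d] l by auto
  show "card (star S d) = card S" using st dn l assms(1)
    by (metis card_Suc_Diff1 card_insert_disjoint finite_Diff)
  have "card {e \<in> D. v \<le> e} \<le> card {e \<in> star S d. v \<le> e}" for v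
  proof (cases "d < v \<and> v \<le> l")
    case True
    have "{e \<in> S. d \<le> e} = {e \<in> S. v \<le> e}" using True least by force
    moreover have "card {e \<in> insert d D. d \<le> e} \<le> card {e \<in> S. d \<le> e}"
      using assms(3) unfolding dominates_def by blast
    moreover have "{e \<in> insert d D. d \<le> e} = insert d D" using assms(4) by auto
    moreover have "card (insert d D) = Suc (card D)" using assms(2,4) by (subst card_insert_disjoint) auto
    moreover have "card {e \<in> D. v \<le> e} \<le> card D" using assms(2) by (intro card_mono) auto
    moreover have "card {e \<in> S. v \<le> e} = 1 + card {e \<in> S - {l}. v \<le> e}"
      using card_Collect_remove[OF assms(1) l(1), of "\<lambda>e. v \<le> e"] True by simp
    moreover have "{e \<in> star S d. v \<le> e} = {e \<in> S - {l}. v \<le> e}" using True st by auto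
    ultimately show ?thesis by simp
  next
    case False
    have "card {e \<in> D. v \<le> e} \<le> card {e \<in> insert d D. v \<le> e}" using assms(2) by (intro card_mono) auto
    also have "\<dots> \<le> card {e \<in> S. v \<le> e}" using assms(3) unfolding dominates_def by blast
    also have "\<dots> = (if v \<le> l then 1 else 0) + card {e \<in> S - {l}. v \<le> e}"
      using card_Collect_remove[OF assms(1) l(1), of "\<lambda>e. v \<le> e"] .
    also have "\<dots> \<le> card {e \<in> star S d. v \<le> e}"
      using card_Collect_insert[of "S - {l}" d "\<lambda>e. v \<le> e"] dn assms(1) False l unfolding st by auto
    finally show ?thesis .
  qed
  then show "dominates (star S d) D" unfolding dominates_def by blast
qed

text \<open>The letters read survive because all later ones are larger. The equality of sizes will
  give the right key the shape of its tableau.\<close>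

lemma foldl_star_dominated:
  assumes "finite S" "sorted_wrt (<) ds" "dominates S (set ds)"
  shows "card (foldl star S ds) = card S" "set ds \<subseteq> foldl star S ds"
proof -
  have "card (foldl star S ds) = card S \<and> set ds \<subseteq> foldl star S ds"
    using assms
  proof (induction ds arbitrary: S)
    case (Cons d ds)
    have "d \<in> star S d" by (simp add: in_star_iff)
    moreover have "card (star S d) = card S" "dominates (star S d) (set ds)"
      using star_dominates[of S "set ds" d] Cons.prems by auto
    ultimately show ?case using Cons.IH[of "star S d"] Cons.prems foldl_star_keep_less[of d "star S d" ds]
      by auto
  qed simp
  then show "card (foldl star S ds) = card S" "set ds \<subseteq> foldl star S ds" by auto
qed

section \<open>Knuth relations for the star action\<close>

lemma star_below: "e < m \<Longrightarrow> e \<in> star S m \<longleftrightarrow> e \<in> S"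
  by (auto simp: in_star_iff)

lemma star_above: "m < e \<Longrightarrow> e \<in> star S m \<longleftrightarrow> e \<in> S \<and> (\<exists>t\<in>S. m \<le> t \<and> t < e)"
  by (auto simp: in_star_iff)

text \<open>The relation \<open>x c y ~ c x y\<close>, a Knuth relation for the reversed order.
  Membership of \<open>e\<close> is compared according to its position relative to \<open>c\<close>,
  \<open>y\<close> and \<open>x\<close>; a letter has no effect on elements below it, so
  \<open>e > x\<close> is the substantial case.\<close>

lemma star_knuth1:
  assumes "c < y" "y \<le> x"
  shows "star (star (star S x) c) y = star (star (star S c) x) y"
proof (intro set_eqI)
  fix e
  have mid: "t \<in> star (star S x) c \<longleftrightarrow> t \<in> star S c" if "c < t" "t < x" for t
  proof -
    have "u \<in> star S x \<longleftrightarrow> u \<in> S" if "u \<le> t" for u using that \<open>t < x\<close> by (simp add: star_below)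
    then show ?thesis using \<open>c < t\<close> by (auto simp: star_above)
  qed
  have ex: "(\<exists>t\<in>star (star S x) c. y \<le> t \<and> t < e') \<longleftrightarrow> (\<exists>t\<in>star (star S c) x. y \<le> t \<and> t < e')"
    if "e' \<le> x" for e'
  proof -
    have "t \<in> star (star S x) c \<longleftrightarrow> t \<in> star (star S c) x" if "y \<le> t" "t < e'" for t
      using mid[of t] that \<open>e' \<le> x\<close> assms by (simp add: star_below)
    then show ?thesis by blast
  qed
  consider "e < c" | "e = c" | "c < e" "e < y" | "e = y" | "y < e" "e < x" | "y < e" "e = x" | "x < e"
    using assms by linarith
  then show "e \<in> star (star (star S x) c) y \<longleftrightarrow> e \<in> star (star (star S c) x) y"
  proof cases
    case 3
    then show ?thesis using assms mid[of e] by (simp add: star_below)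
  next
    case 5
    then show ?thesis using mid[of e] ex[of e] assms by (simp add: star_above star_below)
  next
    case 6
    have "x \<in> star (star S x) c" if t: "t \<in> star (star S x) c" "y \<le> t" "t < x" for t
    proof -
      have "t \<in> star S c" using mid[of t] t assms by simp
      then obtain u where "u \<in> S" "c \<le> u" "u < t" using t assms by (auto simp: star_above)
      then have "u \<in> star S x" "u < x" using t by (auto simp: star_below)
      then show ?thesis using \<open>c \<le> u\<close> by (auto simp: in_star_iff)
    qed
    then show ?thesis using 6 ex[of x] by (auto simp: in_star_iff[of _ _ y] in_star_iff[of x "star S c" x])
  next
    case 7
    \<comment> \<open>To survive a letter, \<open>e\<close> needs a witness between that letter and
      itself. On the left \<open>c\<close> is harmless because \<open>x\<close> is present, on the
      right \<open>y\<close> is harmless for the same reason. What remains is survival of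
      \<open>x\<close> and \<open>y\<close> on one side, of \<open>c\<close> and \<open>x\<close> on
      the other.\<close>
    let ?l = "\<exists>t\<in>star (star S x) c. y \<le> t \<and> t < e" and ?r = "\<exists>t\<in>star S c. x \<le> t \<and> t < e"
    let ?m = "e \<in> S \<and> (\<exists>t\<in>S. x \<le> t \<and> t < e)"
    have xs: "x \<in> star S x" by (simp add: in_star_iff)
    have l: "e \<in> star (star (star S x) c) y \<longleftrightarrow> ?m \<and> ?l"
    proof -
      have "\<exists>t\<in>star S x. c \<le> t \<and> t < e" using 7 assms xs by (intro bexI[of _ x]) auto
      then show ?thesis using 7 assms by (simp add: star_above)
    qed
    have r: "e \<in> star (star (star S c) x) y \<longleftrightarrow> e \<in> star S c \<and> ?r"
    proof -
      have "x \<in> star (star S c) x" by (simp add: in_star_iff)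
      then show ?thesis
        using 7 assms by (subst star_above, simp, subst star_above) auto
    qed
    have "e \<in> star S c \<and> ?r" if m: ?m and t: "t \<in> star (star S x) c" "y \<le> t" "t < e" for t
    proof -
      obtain u where u: "u \<in> S" "x \<le> u" "u < e" using m by blast
      have "\<exists>t\<in>S. c \<le> t \<and> t < e" using u assms by (intro bexI[of _ u]) auto
      then have "e \<in> star S c" using m 7 assms by (simp add: star_above)
      moreover have ?r
      proof (cases "t \<le> x")
        case True
        obtain v where "v \<in> star S x" "c \<le> v" "v < t" using t assms by (auto simp: star_above)
        then have "v \<in> S" "c \<le> v" "v < u" using True u by (auto simp: star_below)
        then have "u \<in> star S c" by (auto simp: in_star_iff u)
        then show ?thesis using u by blast
      next
        case False
        then have "t \<in> star S x" using t assms by (simp add: star_above)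
        then obtain v where v2: "t \<in> S" "v \<in> S" "x \<le> v" "v < t" using False by (auto simp: star_above)
        have "\<exists>w\<in>S. c \<le> w \<and> w < t" using v2 assms by (intro bexI[of _ v]) auto
        then have "t \<in> star S c" using v2 assms False by (simp add: star_above)
        then show ?thesis using False t by (intro bexI[of _ t]) auto
      qed
      ultimately show ?thesis ..
    qed
    moreover have "?m \<and> ?l" if e: "e \<in> star S c" and t: "t \<in> star S c" "x \<le> t" "t < e" for t
    proof -
      obtain v where v: "t \<in> S" "v \<in> S" "c \<le> v" "v < t" using t assms by (auto simp: star_above)
      have "e \<in> S" using e 7 assms by (simp add: star_above)
      moreover have ?l
      proof (cases "v < x")
        case True
        then have "v \<in> star S x" using v by (simp add: star_below)
        then have "x \<in> star (star S x) c" using v True by (auto simp: in_star_iff[of x _ c] xs)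
        then show ?thesis using 7 assms by auto
      next
        case False
        then have "\<exists>w\<in>S. x \<le> w \<and> w < t" using v by (intro bexI[of _ v]) auto
        then have "t \<in> star S x" using v by (simp add: in_star_iff)
        moreover have "x < t" using False v by simp
        moreover from this have "\<exists>w\<in>star S x. c \<le> w \<and> w < t" using xs assms by (intro bexI[of _ x]) auto
        ultimately have "t \<in> star (star S x) c" using assms by (simp add: star_above)
        then show ?thesis using t assms by (meson le_trans)
      qed
      ultimately show ?thesis using v t by blast
    qed
    ultimately show ?thesis unfolding l r by blast
  qed (use assms in \<open>simp_all add: in_star_iff\<close>)
qed

text \<open>The relation \<open>x y z ~ x z y\<close>. Once \<open>x\<close> is in the set,
  \<open>y\<close> displaces an element that is at most \<open>x\<close>, while \<open>z\<close>
  displaces only elements above \<open>x\<close>, so the two do not interfere.\<close>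

lemma star_knuth2:
  assumes "y \<le> x" "x < z"
  shows "star (star (star S x) y) z = star (star (star S x) z) y"
proof (intro set_eqI)
  fix e
  consider "e < y" | "e = y" | "y < e" "e < x" | "e = x" | "x < e" "e < z" | "e = z" | "z < e" by linarith
  then show "e \<in> star (star (star S x) y) z \<longleftrightarrow> e \<in> star (star (star S x) z) y"
  proof cases
    case 3
    then show ?thesis using assms by (simp add: in_star_iff) (metis in_star_iff nless_le order_less_le_trans)
  next
    case 4
    then show ?thesis using assms by (simp add: in_star_iff) (metis in_star_iff order_less_trans)
  next
    case 5
    then show ?thesis using assms by (simp add: in_star_iff) (meson in_star_iff order_less_trans)
  next
    case 6
    then show ?thesis using assms by (simp add: in_star_iff) (meson in_star_iff)
  next
    case 7
    have "x \<in> star S x" "z \<in> star (star S x) z" by (simp_all add: in_star_iff)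
    moreover have "t \<in> star (star S x) y \<longleftrightarrow> t \<in> star S x" if "x < t" for t
      using that assms \<open>x \<in> star S x\<close> by (auto simp: in_star_iff[of t "star S x"])
    then have "(\<exists>t\<in>star (star S x) y. z \<le> t \<and> t < e) \<longleftrightarrow> (\<exists>t\<in>star S x. z \<le> t \<and> t < e)"
      "e \<in> star (star S x) y \<longleftrightarrow> e \<in> star S x"
      using 7 assms by (blast intro: less_le_trans, simp)
    moreover have "\<exists>t\<in>star (star S x) z. y \<le> t \<and> t < e"
      using 7 assms \<open>z \<in> star (star S x) z\<close> by (intro bexI[of _ z]) auto
    ultimately show ?thesis using 7 assms by (simp add: star_above[of z e] star_above[of y e])
  qed (use assms in \<open>simp_all add: in_star_iff\<close>)
qed

text \<open>The letter \<open>x\<close> travels right through \<open>A\<close> by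
  \<open>star_knuth1\<close>, with the next letter of the increasing word as third letter; the final
  \<open>y\<close> is that third letter for the last exchange.\<close>

lemma foldl_star_below:
  assumes "sorted_wrt (<) (A @ [y])" "y \<le> x"
  shows "foldl star (star S x) (A @ [y]) = star (star (foldl star S A) x) y"
  using assms
proof (induction A arbitrary: S)
  case (Cons a A)
  show ?case
  proof (cases A)
    case Nil
    then show ?thesis using Cons.prems star_knuth1[of a y x S] by simp
  next
    case (Cons b B)
    then have "foldl star (star S x) ((a # A) @ [y]) = foldl star (star (star (star S x) a) b) (B @ [y])"
      by simp
    also have "\<dots> = foldl star (star (star (star S a) x) b) (B @ [y])"
      using star_knuth1[of a b x S] Cons.prems Cons by simp
    also have "\<dots> = foldl star (star (star S a) x) (A @ [y])" using Cons by simp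
    finally show ?thesis using Cons.IH[of "star S a"] Cons.prems by simp
  qed
qed simp

text \<open>The letter \<open>y\<close> travels right through \<open>B\<close> by
  \<open>star_knuth2\<close>; after each exchange the letter just passed replaces \<open>x\<close>
  as pivot.\<close>

lemma foldl_star_above_commute:
  assumes "sorted_wrt (<) B" "\<forall>b\<in>set B. x < b" "y \<le> x"
  shows "foldl star (star (star S x) y) B = star (foldl star (star S x) B) y"
  using assms
proof (induction B arbitrary: S x)
  case (Cons b B)
  have "foldl star (star (star S x) y) (b # B) = foldl star (star (star (star S x) b) y) B"
    using star_knuth2[of y x b S] Cons.prems by simp
  also have "\<dots> = star (foldl star (star (star S x) b) B) y"
    using Cons.IH[of b "star S x"] Cons.prems by auto
  finally show ?case by simp
qed simp

subsection \<open>Column insertion\<close>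

definition bumped :: "nat set \<Rightarrow> nat \<Rightarrow> nat" where
  "bumped C x = Max {y \<in> C. y \<le> x}"

definition insert_into_column :: "nat set \<Rightarrow> nat \<Rightarrow> nat set" where
  "insert_into_column C x = (if \<forall>y\<in>C. x < y then insert x C else insert x (C - {bumped C x}))"

lemma bumped:
  assumes "finite C" "\<not> (\<forall>y\<in>C. x < y)"
  shows "bumped C x \<in> C" "bumped C x \<le> x" "z \<in> C \<Longrightarrow> z \<le> x \<Longrightarrow> z \<le> bumped C x"
proof -
  have "finite {y \<in> C. y \<le> x}" "{y \<in> C. y \<le> x} \<noteq> {}" using assms by (auto simp: not_less)
  from Max_in[OF this] Max_ge[OF this(1)]
  show "bumped C x \<in> C" "bumped C x \<le> x" "z \<in> C \<Longrightarrow> z \<le> x \<Longrightarrow> z \<le> bumped C x"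
    unfolding bumped_def by auto
qed

lemma finite_insert_into_column [simp]: "finite C \<Longrightarrow> finite (insert_into_column C x)"
  by (simp add: insert_into_column_def)

lemma card_insert_into_column:
  assumes "finite C"
  shows "card {e \<in> insert_into_column C x. v \<le> e} =
    card {e \<in> C. v \<le> e} + (if v \<le> x \<and> (\<forall>z\<in>C. z \<le> x \<longrightarrow> z < v) then 1 else 0)"
proof (cases "\<forall>y\<in>C. x < y")
  case True
  then have "x \<notin> C" by auto
  then show ?thesis
    using card_Collect_insert[OF assms, of x "\<lambda>e. v \<le> e"] True by (auto simp: insert_into_column_def)
next
  case False
  note b = bumped[OF assms False]
  have n: "x \<notin> C - {bumped C x}" using b(2) b(3)[of x] by auto
  have "(\<forall>z\<in>C. z \<le> x \<longrightarrow> z < v) \<longleftrightarrow> bumped C x < v" using b by fastforce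
  then show ?thesis
    using card_Collect_insert[of "C - {bumped C x}" x "\<lambda>e. v \<le> e"] n assms b(2)
      card_Collect_remove[OF assms b(1), of "\<lambda>e. v \<le> e"] False
    by (auto simp: insert_into_column_def)
qed

text \<open>Let \<open>y\<close> be the bumped letter. The count for \<open>D\<close> grows at
  \<open>v\<close> only if \<open>v <= y\<close> and \<open>D\<close> has no element in
  \<open>[v, y]\<close>. Then it equals the count above \<open>y\<close>, and \<open>C\<close> has
  one element to spare, namely \<open>y\<close> itself.\<close>

lemma dominates_insert_into_column:
  assumes "finite C" "finite D" "dominates C D" "\<not> (\<forall>y\<in>C. x < y)"
  shows "dominates (insert_into_column C x) (insert_into_column D (bumped C x))"
  unfolding dominates_def
proof
  fix v
  let ?y = "bumped C x"
  note b = bumped[OF assms(1,4)]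
  have "card {b \<in> insert_into_column D ?y. v \<le> b} \<le> card {a \<in> C. v \<le> a}"
  proof (cases "v \<le> ?y \<and> (\<forall>z\<in>D. z \<le> ?y \<longrightarrow> z < v)")
    case True
    then have "{b \<in> D. v \<le> b} = {b \<in> D. Suc ?y \<le> b}" by force
    then have "card {b \<in> D. v \<le> b} \<le> card {a \<in> C. Suc ?y \<le> a}"
      using assms(3) unfolding dominates_def by simp
    also have "\<dots> < card {a \<in> C. v \<le> a}"
    proof (rule psubset_card_mono)
      show "{a \<in> C. Suc ?y \<le> a} \<subset> {a \<in> C. v \<le> a}"
        using True b(1) by (intro psubsetI) (auto simp: set_eq_iff intro: exI[of _ ?y])
    qed (use assms(1) in simp)
    finally show ?thesis using card_insert_into_column[OF assms(2), of ?y v] True by simp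
  next
    case False
    then show ?thesis
      using card_insert_into_column[OF assms(2), of ?y v] assms(3) unfolding dominates_def by auto
  qed
  also have "\<dots> \<le> card {a \<in> insert_into_column C x. v \<le> a}"
    using card_insert_into_column[OF assms(1), of x v] by simp
  finally show "card {b \<in> insert_into_column D ?y. v \<le> b} \<le> card {a \<in> insert_into_column C x. v \<le> a}" .
qed

section \<open>Tableaux as chains of dominating columns\<close>

definition first_column :: "tableau \<Rightarrow> nat set" where
  "first_column T = (if T = [] then {} else set (hd T))"

lemma first_column_simps [simp]:
  "first_column [] = {}" "first_column (C # Cs) = set C" "finite (first_column T)"
  by (auto simp: first_column_def)

lemma rssyt_Nil [simp]: "rssyt []"
  by (simp add: rssyt_def shape_def)

text \<open>The form suited to induction over columns: the shape and row conditions between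
  neighbours merge into one dominance. Because \<open>first_column\<close> is empty on the empty
  tableau, the last column is no special case.\<close>

lemma rssyt_Cons:
  "rssyt (C # Cs) \<longleftrightarrow> C \<noteq> [] \<and> (\<forall>x\<in>set C. 0 < x) \<and> sorted_wrt (>) C \<and>
     dominates (set C) (first_column Cs) \<and> rssyt Cs"
proof (cases Cs)
  case Nil
  then show ?thesis by (auto simp: rssyt_def shape_def)
next
  case (Cons D Ds)
  let ?r = "\<lambda>T. \<forall>c r. Suc c < length T \<longrightarrow> r < length (T ! Suc c) \<longrightarrow> T ! c ! r \<ge> T ! Suc c ! r"
  have "?r (C # D # Ds) \<longleftrightarrow> (\<forall>r < length D. D ! r \<le> C ! r) \<and> ?r (D # Ds)"
    (is "?l \<longleftrightarrow> ?h \<and> ?t")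
  proof
    assume ?l
    then show "?h \<and> ?t" by (auto dest: spec[of _ 0] spec[of _ "Suc _"])
  next
    assume r: "?h \<and> ?t"
    show ?l
    proof (intro allI impI)
      fix c r
      assume "Suc c < length (C # D # Ds)" "r < length ((C # D # Ds) ! Suc c)"
      with r show "(C # D # Ds) ! c ! r \<ge> (C # D # Ds) ! Suc c ! r" by (cases c) auto
    qed
  qed
  moreover have "sorted_wrt (\<ge>) (shape (C # D # Ds)) \<longleftrightarrow> length D \<le> length C \<and> sorted_wrt (\<ge>) (shape (D # Ds))"
    by (auto simp: shape_def)
  moreover have "dominates (set C) (set D) \<longleftrightarrow> length D \<le> length C \<and> (\<forall>r < length D. D ! r \<le> C ! r)"
    if "sorted_wrt (>) C" "sorted_wrt (>) D" using dominates_iff_nth[OF that] .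
  ultimately show ?thesis unfolding Cons rssyt_def by auto
qed

definition bump :: "nat list \<Rightarrow> nat \<Rightarrow> nat list" where
  "bump C x = map (\<lambda>z. if z = bumped (set C) x then x else z) C"

lemma column_insert_append:
  "\<forall>y \<in> set C. x < y \<Longrightarrow> column_insert x (C # Cs) = ((C @ [x]) # Cs, 0)"
  by simp

lemma column_insert_bump:
  "\<not> (\<forall>y \<in> set C. x < y) \<Longrightarrow> column_insert x (C # Cs) =
     (bump C x # fst (column_insert (bumped (set C) x) Cs), Suc (snd (column_insert (bumped (set C) x) Cs)))"
  by (auto simp: bumped_def bump_def Let_def split: prod.splits)

declare column_insert.simps(2) [simp del]

lemma set_bump:
  assumes "\<not> (\<forall>y\<in>set C. x < y)"
  shows "set (bump C x) = insert_into_column (set C) x"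
  using assms bumped(1)[OF _ assms] by (auto simp: bump_def insert_into_column_def)

lemma sorted_bump:
  assumes "sorted_wrt (>) C" "\<not> (\<forall>y\<in>set C. x < y)"
  shows "sorted_wrt (>) (bump C x)"
  unfolding bump_def sorted_wrt_map
  by (rule sorted_wrt_mono_rel[OF _ assms(1)]) (use bumped[OF _ assms(2)] in force)

lemma bump_nonempty [simp]: "bump C x = [] \<longleftrightarrow> C = []"
  by (simp add: bump_def)

lemma first_column_insert:
  assumes "rssyt T"
  shows "first_column (fst (column_insert x T)) = insert_into_column (first_column T) x"
proof (cases T)
  case Nil
  then show ?thesis by (simp add: insert_into_column_def)
next
  case (Cons C Cs)
  then show ?thesis
    by (cases "\<forall>y\<in>set C. x < y")
      (simp_all add: column_insert_append column_insert_bump set_bump insert_into_column_def)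
qed

lemma rssyt_column_insert:
  assumes "rssyt T" "0 < x"
  shows "rssyt (fst (column_insert x T))"
  using assms
proof (induction T arbitrary: x)
  case Nil
  then show ?case by (simp add: rssyt_Cons)
next
  case (Cons C Cs)
  have T: "C \<noteq> []" "\<forall>x\<in>set C. 0 < x" "sorted_wrt (>) C" "dominates (set C) (first_column Cs)" "rssyt Cs"
    using Cons.prems by (auto simp: rssyt_Cons)
  show ?case
  proof (cases "\<forall>y\<in>set C. x < y")
    case True
    have "dominates (set (C @ [x])) (first_column Cs)"
      using T(4) dominates_superset dominates_trans by (metis List.finite_set set_append sup_ge1)
    then show ?thesis
      using True T Cons.prems by (auto simp: column_insert_append rssyt_Cons sorted_wrt_append)
  next
    case False
    note b = bumped[OF _ False, simplified]
    let ?y = "bumped (set C) x"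
    have "rssyt (fst (column_insert ?y Cs))" using Cons.IH T b(1) by blast
    moreover have "dominates (set (bump C x)) (first_column (fst (column_insert ?y Cs)))"
      unfolding set_bump[OF False] first_column_insert[OF T(5)]
      using dominates_insert_into_column[OF _ _ T(4) False] by simp
    moreover have "\<forall>z\<in>set (bump C x). 0 < z"
      using T(2) Cons.prems(2) by (auto simp: set_bump[OF False] insert_into_column_def split: if_splits)
    ultimately show ?thesis
      using T(1) sorted_bump[OF T(3) False] by (simp add: column_insert_bump[OF False] rssyt_Cons)
  qed
qed

lemma word_Nil [simp]: "word [] = []"
  and word_Cons [simp]: "word (C # Cs) = rev C @ word Cs"
  by (simp_all add: word_def)

lemma sorted_split:
  assumes "sorted_wrt (>) C" "y \<in> set C"
  obtains A B where "C = A @ [y] @ B" "\<forall>a\<in>set A. y < a" "\<forall>b\<in>set B. b < (y::nat)"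
proof -
  obtain A B where "C = A @ y # B" using assms(2) by (meson split_list)
  with assms(1) that show thesis by (auto simp: sorted_wrt_append)
qed

text \<open>Write the column word as \<open>A y B\<close> with \<open>A < y < B\<close>. Then
  \<open>x A y B\<close> becomes \<open>A x y B\<close> by \<open>foldl_star_below\<close> and
  \<open>A x B y\<close> by \<open>foldl_star_above_commute\<close>: the bumped column followed by
  the displaced letter.\<close>

lemma foldl_star_bump:
  assumes "sorted_wrt (>) C" "\<not> (\<forall>y\<in>set C. x < y)"
  defines "y \<equiv> bumped (set C) x"
  shows "star (foldl star S (rev (bump C x))) y = foldl star (star S x) (rev C)"
proof -
  have b: "y \<in> set C" "y \<le> x" "\<And>z. z \<in> set C \<Longrightarrow> z \<le> x \<Longrightarrow> z \<le> y"
    using bumped[OF _ assms(2)] unfolding y_def by auto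
  obtain B A where C: "C = B @ [y] @ A" and AB: "\<forall>a\<in>set B. y < a" "\<forall>b\<in>set A. b < y"
    using sorted_split[OF assms(1) b(1)] .
  have s: "sorted_wrt (<) (rev A @ [y])" "sorted_wrt (<) (rev B)"
    using assms(1) AB unfolding C by (auto simp: sorted_wrt_append sorted_wrt_rev)
  have xB: "\<forall>b\<in>set (rev B). x < b" using AB b(3) unfolding C by (auto simp: not_le[symmetric])
  have m: "rev (bump C x) = rev A @ [x] @ rev B"
    using AB unfolding bump_def y_def[symmetric] unfolding C by (auto intro!: map_idI)
  have "foldl star (star S x) (rev C) = foldl star (foldl star (star S x) (rev A @ [y])) (rev B)"
    unfolding C by simp
  also have "\<dots> = foldl star (star (star (foldl star S (rev A)) x) y) (rev B)"
    using foldl_star_below[OF s(1) b(2)] by simp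
  also have "\<dots> = star (foldl star (star (foldl star S (rev A)) x) (rev B)) y"
    using foldl_star_above_commute[OF s(2) xB b(2)] .
  finally show ?thesis unfolding m by simp
qed

text \<open>The letter displaced from one column is the letter inserted into the next, so the
  single-column identity telescopes. The starting set is arbitrary because it changes from column to
  column.\<close>

lemma foldl_star_column_insert:
  assumes "rssyt T"
  shows "foldl star S (word (fst (column_insert x T))) = foldl star (star S x) (word T)"
  using assms
proof (induction T arbitrary: x S)
  case (Cons C Cs)
  show ?case
  proof (cases "\<forall>y\<in>set C. x < y")
    case False
    then show ?thesis
      using Cons foldl_star_bump[OF _ False] by (simp add: column_insert_bump[OF False] rssyt_Cons)
  qed (simp add: column_insert_append)
qed simp


subsection \<open>Right keys\<close>

lemma rssyt_drop: "rssyt T \<Longrightarrow> rssyt (drop j T)"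
proof (induction T arbitrary: j)
  case (Cons C Cs)
  then show ?case by (cases j) (auto simp: rssyt_Cons)
qed simp

definition column :: "tableau \<Rightarrow> nat \<Rightarrow> nat list" where
  "column T j = (if j < length T then T ! j else [])"

lemma first_column_drop: "first_column (drop j T) = set (column T j)"
  by (auto simp: first_column_def column_def hd_drop_conv_nth)

lemma sorted_column: "rssyt T \<Longrightarrow> sorted_wrt (>) (column T j)"
  by (simp add: rssyt_def column_def)

lemma sorted_rssyt_hd: "rssyt (C # Cs) \<Longrightarrow> sorted_wrt (<) (rev C)"
  by (simp add: rssyt_Cons sorted_wrt_rev)

lemma dominates_mono:
  assumes "dominates A B" "A \<subseteq> A'" "finite A'" "B' \<subseteq> B" "finite B"
  shows "dominates A' B'"
  using dominates_trans[OF dominates_superset[OF assms(3,2)]]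
    dominates_trans[OF assms(1) dominates_superset[OF assms(5,4)]] by blast

text \<open>Once a column has been read, the set contains it and therefore dominates the next
  column.\<close>

lemma card_foldl_star_word:
  assumes "rssyt T" "finite S" "dominates S (first_column T)"
  shows "card (foldl star S (word T)) = card S"
  using assms
proof (induction T arbitrary: S)
  case (Cons C Cs)
  let ?S = "foldl star S (rev C)"
  have d: "dominates S (set (rev C))" using Cons.prems(3) by simp
  note s = foldl_star_dominated[OF Cons.prems(2) sorted_rssyt_hd[OF Cons.prems(1)] d]
  have "dominates ?S (first_column Cs)"
    using s(2) Cons.prems by - (rule dominates_mono[of "set C" "first_column Cs"], simp_all add: rssyt_Cons)
  then have "card (foldl star ?S (word Cs)) = card ?S"
    using Cons.prems by (intro Cons.IH) (simp_all add: rssyt_Cons)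
  then show ?case using s(1) by simp
qed simp

definition right_key_column :: "tableau \<Rightarrow> nat \<Rightarrow> nat set" where
  "right_key_column P j = foldl star {} (word (drop j P))"

lemma finite_right_key_column [simp]: "finite (right_key_column P j)"
  by (simp add: right_key_column_def)

lemma card_foldl_star_word_empty:
  assumes "rssyt T"
  shows "card (foldl star {} (word T)) = card (first_column T)"
proof (cases T)
  case (Cons C Cs)
  have "foldl star {} (rev C) = set C"
    using foldl_star_above[of "rev C" "{}"] sorted_rssyt_hd assms unfolding Cons by simp
  then show ?thesis
    using card_foldl_star_word[of Cs "set C"] assms unfolding Cons by (simp add: rssyt_Cons)
qed simp

lemma card_right_key_column:
  "rssyt P \<Longrightarrow> card (right_key_column P j) = card (set (column P j))"
  unfolding right_key_column_def first_column_drop[symmetric]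
  by (intro card_foldl_star_word_empty rssyt_drop)

text \<open>Dropping a column means reading the same remaining word from the empty set instead of
  from what that column produced; \<open>star\<close> is monotone.\<close>

lemma right_key_column_Suc: "right_key_column P (Suc j) \<subseteq> right_key_column P j"
proof (cases "j < length P")
  case True
  then have "drop j P = P ! j # drop (Suc j) P" by (simp add: Cons_nth_drop_Suc)
  then show ?thesis unfolding right_key_column_def by (simp add: foldl_star_mono)
qed (simp add: right_key_column_def)

text \<open>
  Applied with \<open>A\<close>, \<open>B\<close>, \<open>B'\<close> evolving into column \<open>c + 1\<close> of the right key, its column \<open>c\<close>, and column \<open>c\<close> after
  the insertion.
\<close>

lemma foldl_star_new:
  assumes "B \<subseteq> B'" "\<And>e t. e \<in> B \<Longrightarrow> t \<in> B' - B \<Longrightarrow> e < t \<Longrightarrow> e \<in> A"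
    and "e \<in> foldl star B w" "t \<in> foldl star B' w - foldl star B w" "e < t"
  shows "e \<in> foldl star A w"
  using assms
proof (induction w arbitrary: A B B')
  case (Cons m w)
  have "e \<in> star A m" if e: "e \<in> star B m" and t: "t \<in> star B' m" "t \<notin> star B m" and et: "e < t" for e t
  proof (cases "e = m")
    case False
    then have eB: "e \<in> B" "e < m \<or> (\<exists>u\<in>B. m \<le> u \<and> u < e)" using e by (auto simp: in_star_iff)
    have tm: "t \<noteq> m" using t by (auto simp: in_star_iff)
    then have tB: "t \<in> B'" "t < m \<or> (\<exists>u\<in>B'. m \<le> u \<and> u < t)" using t by (auto simp: in_star_iff)
    show ?thesis
    proof (cases "t \<in> B")
      case True
      with t tm have no: "\<not> t < m" "\<And>u. u \<in> B \<Longrightarrow> m \<le> u \<Longrightarrow> \<not> u < t"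
        unfolding in_star_iff by blast+
      then obtain u where u: "u \<in> B'" "m \<le> u" "u < t" using tB by blast
      then have "u \<in> B' - B" using no by blast
      moreover have "e < m" using no(2)[OF eB(1)] et by linarith
      ultimately show ?thesis using Cons.prems(2)[OF eB(1), of u] u by (simp add: in_star_iff)
    next
      case False
      then have "e \<in> A" using Cons.prems(2)[of e t] eB tB et by blast
      moreover have "u \<in> A" if "u \<in> B" "u < e" for u
        using Cons.prems(2)[of u t] that False tB et by simp
      ultimately show ?thesis using eB(2) unfolding in_star_iff by blast
    qed
  qed (simp add: in_star_iff)
  then have "e \<in> foldl star (star A m) w"
    using Cons.prems(3-5) by - (rule Cons.IH[OF star_mono[OF Cons.prems(1)]], auto)
  then show ?case by simp
qed auto

text \<open>When a letter removes a gained element, it removes from the smaller set a larger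
  element, if any, and that one becomes the gained element. The difference only moves
  upwards.\<close>

lemma foldl_star_new_ge:
  assumes "B \<subseteq> B'" "\<And>t. t \<in> B' - B \<Longrightarrow> x \<le> t" "t \<in> foldl star B' w - foldl star B w"
  shows "x \<le> t"
  using assms
proof (induction w arbitrary: B B')
  case (Cons m w)
  have "x \<le> t" if t: "t \<in> star B' m" "t \<notin> star B m" for t
  proof (cases "t \<in> B")
    case True
    then have no: "t \<noteq> m" "\<not> t < m" "\<And>u. u \<in> B \<Longrightarrow> m \<le> u \<Longrightarrow> \<not> u < t"
      using t unfolding in_star_iff by blast+
    then obtain u where "u \<in> B'" "m \<le> u" "u < t" using t by (auto simp: in_star_iff)
    then show ?thesis using no(3)[of u] Cons.prems(2)[of u] by force
  next
    case False
    then show ?thesis using Cons.prems(2)[of t] t by (auto simp: in_star_iff)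
  qed
  then show ?case
    using Cons.prems(3) by - (rule Cons.IH[OF star_mono[OF Cons.prems(1)]], auto)
qed auto

text \<open>From column \<open>j\<close> on, the process is itself an insertion, of the letter that
  column \<open>j\<close> receives. This reduces column \<open>j\<close> of the right key to the
  first key column of a smaller tableau.\<close>

lemma column_insert_drop_le:
  assumes "column_insert x T = (T', c)" "j \<le> c"
  obtains x' where "column_insert x' (drop j T) = (drop j T', c - j)" "j = 0 \<Longrightarrow> x' = x"
proof -
  have "\<exists>x'. column_insert x' (drop j T) = (drop j T', c - j) \<and> (j = 0 \<longrightarrow> x' = x)"
    using assms
  proof (induction j arbitrary: x T T' c)
    case (Suc j)
    show ?case
    proof (cases T)
      case Nil
      then show ?thesis using Suc.prems by simp
    next
      case (Cons C Cs)
      obtain Cs' c' where r: "column_insert (bumped (set C) x) Cs = (Cs', c')" by fastforce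
      have "\<not> (\<forall>y\<in>set C. x < y)"
        using Suc.prems column_insert_append[of C x Cs] unfolding Cons by auto
      with Suc.prems r have "T' = bump C x # Cs'" "c = Suc c'" unfolding Cons by (auto simp: column_insert_bump)
      then show ?thesis using Suc.IH[OF r] Suc.prems unfolding Cons by auto
    qed
  qed auto
  then show thesis using that by blast
qed

lemma column_insert_drop_greater:
  assumes "column_insert x T = (T', c)" "c < j"
  shows "drop j T' = drop j T"
  using assms
proof (induction T arbitrary: x T' c j)
  case (Cons C Cs)
  show ?case
  proof (cases "\<forall>y\<in>set C. x < y")
    case True
    then show ?thesis using Cons.prems by (cases j) (auto simp: column_insert_append)
  next
    case False
    obtain Cs' c' where r: "column_insert (bumped (set C) x) Cs = (Cs', c')" by fastforce
    with Cons.prems False have "T' = bump C x # Cs'" "c = Suc c'" by (auto simp: column_insert_bump)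
    then show ?thesis using Cons.IH[OF r, of "j - 1"] Cons.prems by (cases j) auto
  qed
qed auto

lemma column_insert_index_eq_0:
  "snd (column_insert x T) = 0 \<longleftrightarrow> (\<forall>y\<in>first_column T. x < y)"
proof (cases T)
  case (Cons C Cs)
  then show ?thesis
    by (cases "\<forall>y\<in>set C. x < y") (simp_all add: column_insert_append column_insert_bump)
qed simp

lemma card_insert_into_column_full:
  "finite C \<Longrightarrow> card (insert_into_column C x) = card C + (if \<forall>y\<in>C. x < y then 1 else 0)"
  using card_insert_into_column[of C x 0] by (auto simp: not_le)

text \<open>The new tableau acts like \<open>x\<close> followed by the old word, i.e. like the old
  word started from \<open>{x}\<close>. Monotonicity gives the inclusion, and the sizes are those of
  the first columns.\<close>

lemma foldl_star_column_insert_empty: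
  assumes "rssyt T" "column_insert x T = (T', c)" "rssyt T'"
  shows "foldl star {} (word T') = foldl star {x} (word T)"
    and "foldl star {} (word T) \<subseteq> foldl star {} (word T')"
    and "card (foldl star {} (word T')) = card (foldl star {} (word T)) + (if c = 0 then 1 else 0)"
proof -
  have T': "T' = fst (column_insert x T)" "c = snd (column_insert x T)" using assms(2) by simp_all
  show *: "foldl star {} (word T') = foldl star {x} (word T)"
    using foldl_star_column_insert[OF assms(1), of "{}" x] unfolding T' by (simp add: star_def)
  show "foldl star {} (word T) \<subseteq> foldl star {} (word T')" unfolding * by (rule foldl_star_mono) simp
  show "card (foldl star {} (word T')) = card (foldl star {} (word T)) + (if c = 0 then 1 else 0)"
    unfolding card_foldl_star_word_empty[OF assms(3)] card_foldl_star_word_empty[OF assms(1)]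
    unfolding T' first_column_insert[OF assms(1)] column_insert_index_eq_0
    by (simp add: card_insert_into_column_full)
qed

text \<open>To the left of \<open>c\<close> the inclusion is between sets of equal size; to the
  right the columns are untouched.\<close>

lemma right_key_column_insert_neq:
  assumes "rssyt P" "column_insert x P = (P', c)" "rssyt P'" "j \<noteq> c"
  shows "right_key_column P' j = right_key_column P j"
proof (cases "j < c")
  case True
  then obtain x' where x': "column_insert x' (drop j P) = (drop j P', c - j)"
    using column_insert_drop_le[OF assms(2), of j] by auto
  note * = foldl_star_column_insert_empty[OF rssyt_drop[OF assms(1)] x' rssyt_drop[OF assms(3)]]
  show ?thesis
    using card_subset_eq[OF _ *(2)] *(3) True unfolding right_key_column_def by simp
next
  case False
  then show ?thesis
    using column_insert_drop_greater[OF assms(2)] assms(4) unfolding right_key_column_def by simp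
qed

lemma right_key_column_insert_eq:
  assumes "rssyt P" "column_insert x P = (P', c)" "rssyt P'"
  obtains t where "right_key_column P' c = insert t (right_key_column P c)"
    "t \<notin> right_key_column P c"
    "\<And>e. e \<in> right_key_column P c \<Longrightarrow> e < t \<Longrightarrow> e \<in> right_key_column P (Suc c)"
    "c = 0 \<Longrightarrow> x \<le> t"
proof -
  obtain x' where x': "column_insert x' (drop c P) = (drop c P', 0)" "c = 0 \<Longrightarrow> x' = x"
    using column_insert_drop_le[OF assms(2), of c] by auto
  note * = foldl_star_column_insert_empty[OF rssyt_drop[OF assms(1)] x'(1) rssyt_drop[OF assms(3)]]
  have sub: "right_key_column P c \<subseteq> right_key_column P' c"
    and card: "card (right_key_column P' c) = Suc (card (right_key_column P c))"
    using *(2,3) unfolding right_key_column_def by simp_all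
  have "card (right_key_column P' c - right_key_column P c) = 1"
    using card sub by (simp add: card_Diff_subset)
  then obtain t where t: "right_key_column P' c - right_key_column P c = {t}"
    by (auto simp: card_1_singleton_iff)
  \<comment> \<open>Seen from column \<open>c\<close>, the insertion stops at once, so
    \<open>x'\<close> lies below the whole column and precedes its increasing word.\<close>
  have less: "\<forall>y\<in>set (column P c). x' < y"
    using column_insert_index_eq_0[of x' "drop c P"] x'(1) by (simp add: first_column_drop)
  have w: "word (drop c P) = rev (column P c) @ word (drop (Suc c) P)"
  proof (cases "c < length P")
    case True
    then have "drop c P = P ! c # drop (Suc c) P" by (simp add: Cons_nth_drop_Suc)
    then show ?thesis using True by (simp add: column_def)
  qed (simp add: column_def)
  have s: "sorted_wrt (<) (rev (column P c))"
    using assms(1) by (simp add: sorted_column sorted_wrt_rev)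
  have R: "right_key_column P c = foldl star (set (column P c)) (word (drop (Suc c) P))"
    using foldl_star_above[OF s, of "{}"] by (simp add: right_key_column_def w)
  have R': "right_key_column P' c = foldl star (insert x' (set (column P c))) (word (drop (Suc c) P))"
    using foldl_star_above[OF s, of "{x'}"] less *(1) by (simp add: right_key_column_def w)
  show thesis
  proof (rule that[of t])
    show "right_key_column P' c = insert t (right_key_column P c)" "t \<notin> right_key_column P c"
      using t sub by auto
    show "e \<in> right_key_column P (Suc c)" if "e \<in> right_key_column P c" "e < t" for e
      unfolding right_key_column_def
    proof (rule foldl_star_new[OF _ _ that(1)[unfolded R] _ that(2)])
      \<comment> \<open>With \<open>A = {}\<close> the remaining word produces column
        \<open>c + 1\<close> of the key. The starting condition is vacuous: no entry of the column
        lies below \<open>x'\<close>.\<close>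
      show "e' \<in> {}" if "e' \<in> set (column P c)"
        "t' \<in> insert x' (set (column P c)) - set (column P c)" "e' < t'" for e' t'
        using that less by auto
      show "t \<in> foldl star (insert x' (set (column P c))) (word (drop (Suc c) P)) -
          foldl star (set (column P c)) (word (drop (Suc c) P))"
        using t unfolding R R' by blast
    qed blast
    show "x \<le> t" if "c = 0"
    proof (rule foldl_star_new_ge)
      show "t \<in> foldl star (insert x' (set (column P c))) (word (drop (Suc c) P)) -
          foldl star (set (column P c)) (word (drop (Suc c) P))"
        using t unfolding R R' by blast
      show "x \<le> t'" if "t' \<in> insert x' (set (column P c)) - set (column P c)" for t'
        using that x'(2)[OF \<open>c = 0\<close>] by auto
    qed blast
  qed
qed

lemma right_key_column_lower:
  assumes "rssyt P" "column_insert x P = (P', c)"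
  shows "\<exists>e\<in>right_key_column P' 0. e \<le> x"
proof -
  have "x \<in> first_column P'"
    using first_column_insert[OF assms(1), of x] assms(2) by (simp add: insert_into_column_def)
  then have "x \<in> set (word P')" by (cases P') auto
  then show ?thesis unfolding right_key_column_def by (intro foldl_star_lower) simp
qed


subsection \<open>Left keys\<close>

text \<open>Dominance makes the \<open>LEAST\<close> exist and passes to the rest: above
  \<open>b\<close> nothing of \<open>C\<close> is lost, and at \<open>v <= b\<close> the bound at
  \<open>d\<close> suffices after cancelling the pair \<open>d\<close>, \<open>b\<close>.\<close>

lemma greedy_match_Cons:
  assumes "finite C" "dominates C (set (d # ds))" "sorted_wrt (<) (d # ds)"
  obtains b where "b \<in> C" "d \<le> b" "\<And>c. c \<in> C \<Longrightarrow> d \<le> c \<Longrightarrow> b \<le> c"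
    "\<And>as. greedy_match C (d # as) = b # greedy_match {c \<in> C. b < c} as"
    "dominates {c \<in> C. b < c} (set ds)"
proof -
  define b where "b = (LEAST b. b \<in> C \<and> d \<le> b)"
  have "\<exists>b. b \<in> C \<and> d \<le> b" using dominatesD_ex[OF assms(2), of d] by auto
  from LeastI_ex[OF this] have b: "b \<in> C" "d \<le> b" by (auto simp: b_def)
  have least: "b \<le> c" if "c \<in> C" "d \<le> c" for c using that unfolding b_def by (simp add: Least_le)
  let ?C = "{c \<in> C. b < c}" and ?D = "set ds"
  have d: "d \<notin> ?D" using assms(3) by auto
  have "card {e \<in> ?D. v \<le> e} \<le> card {e \<in> ?C. v \<le> e}" for v
  proof (cases "b < v")
    case True
    have "card {e \<in> ?D. v \<le> e} \<le> card {e \<in> set (d # ds). v \<le> e}" by (intro card_mono) auto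
    also have "\<dots> \<le> card {e \<in> C. v \<le> e}" using assms(2) unfolding dominates_def by blast
    also have "{e \<in> C. v \<le> e} = {e \<in> ?C. v \<le> e}" using True by auto
    finally show ?thesis .
  next
    case False
    have "card {e \<in> set (d # ds). d \<le> e} \<le> card {e \<in> C. d \<le> e}"
      using assms(2) unfolding dominates_def by blast
    moreover have "{e \<in> set (d # ds). d \<le> e} = insert d ?D" using assms(3) by auto
    moreover have "{e \<in> C. d \<le> e} = insert b ?C" using b least by force
    moreover have "{e \<in> ?C. v \<le> e} = ?C" using False by auto
    moreover have "card {e \<in> ?D. v \<le> e} \<le> card ?D" by (intro card_mono) auto
    ultimately show ?thesis using d assms(1) by simp
  qed
  then have "dominates ?C ?D" unfolding dominates_def by blast
  moreover have "greedy_match C (d # as) = b # greedy_match ?C as" for as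
    by (simp add: b_def Let_def)
  ultimately show thesis using that b least by blast
qed

lemma greedy_match_subset:
  assumes "finite C" "dominates C (set ds)" "sorted_wrt (<) ds"
  shows "set (greedy_match C ds) \<subseteq> C"
  using assms
proof (induction ds arbitrary: C)
  case (Cons d ds)
  obtain b where b: "b \<in> C" "greedy_match C (d # ds) = b # greedy_match {c \<in> C. b < c} ds"
    "dominates {c \<in> C. b < c} (set ds)"
    using greedy_match_Cons[OF Cons.prems] by metis
  then show ?case using Cons.IH[of "{c \<in> C. b < c}"] Cons.prems by auto
qed simp

lemma sorted_wrt_insort:
  "sorted_wrt (<) ds \<Longrightarrow> s \<notin> set ds \<Longrightarrow> sorted_wrt (<) (insort s (ds :: nat list))"
  by (induction ds) (auto simp: set_insort_key)

lemma greedy_match_cong: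
  assumes "\<forall>d\<in>set ds. v \<le> d" "{c \<in> C. v \<le> c} = {c \<in> C'. v \<le> c}"
  shows "greedy_match C ds = greedy_match C' ds"
  using assms
proof (induction ds arbitrary: C C')
  case (Cons d ds)
  have "(\<lambda>b. b \<in> C \<and> d \<le> b) = (\<lambda>b. b \<in> C' \<and> d \<le> b)"
    using Cons.prems by (fastforce simp: set_eq_iff)
  then have "(LEAST b. b \<in> C \<and> d \<le> b) = (LEAST b. b \<in> C' \<and> d \<le> b)" by simp
  moreover have "greedy_match {c \<in> C. b < c} ds = greedy_match {c \<in> C'. b < c} ds" for b
    using Cons.prems by (intro Cons.IH) auto
  ultimately show ?case by (simp add: Let_def)
qed simp

declare greedy_match.simps(2) [simp del]

text \<open>The exchange property: whatever rematching \<open>s\<close> causes, the matched part of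
  \<open>C\<close> gains only the least free element at or above \<open>s\<close>. If
  \<open>s\<close> takes the partner of \<open>d\<close>, then \<open>d\<close> plays the role of
  \<open>s\<close> for the remaining letters, which is why \<open>s\<close> varies in the
  induction.\<close>

lemma greedy_match_insort:
  assumes "finite C" "dominates C (insert s (set ds))" "sorted_wrt (<) ds" "s \<notin> set ds"
  shows "\<exists>b \<in> C - set (greedy_match C ds). s \<le> b \<and>
    (\<forall>c \<in> C - set (greedy_match C ds). s \<le> c \<longrightarrow> b \<le> c) \<and>
    set (greedy_match C (insort s ds)) = insert b (set (greedy_match C ds))"
  using assms
proof (induction ds arbitrary: C s)
  case Nil
  obtain b where "b \<in> C" "s \<le> b" "\<And>c. c \<in> C \<Longrightarrow> s \<le> c \<Longrightarrow> b \<le> c"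
    "greedy_match C (s # []) = b # greedy_match {c \<in> C. b < c} []"
  proof (rule greedy_match_Cons[of C s "[]"])
    show "finite C" "dominates C (set [s])" "sorted_wrt (<) [s]" using Nil by auto
  qed blast
  then show ?case by (intro bexI[of _ b]) auto
next
  case (Cons d ds)
  show ?case
  proof (cases "s < d")
    case True
    have i: "insort s (d # ds) = s # d # ds" using True by simp
    obtain b where b: "b \<in> C" "s \<le> b" "\<And>c. c \<in> C \<Longrightarrow> s \<le> c \<Longrightarrow> b \<le> c"
      "greedy_match C (s # d # ds) = b # greedy_match {c \<in> C. b < c} (d # ds)"
      "dominates {c \<in> C. b < c} (set (d # ds))"
    proof (rule greedy_match_Cons[of C s "d # ds"])
      show "finite C" "dominates C (set (s # d # ds))" "sorted_wrt (<) (s # d # ds)"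
        using Cons.prems True by auto
    qed blast
    show ?thesis
    proof (cases "b < d")
      case True
      \<comment> \<open>The partner of \<open>s\<close> lies below all later letters, so their
        choices are unaffected.\<close>
      have eq: "greedy_match {c \<in> C. b < c} (d # ds) = greedy_match C (d # ds)"
        using Cons.prems(3) True by (intro greedy_match_cong[of _ d]) auto
      have "set (greedy_match {c \<in> C. b < c} (d # ds)) \<subseteq> {c \<in> C. b < c}"
        by (rule greedy_match_subset[OF _ b(5)]) (use Cons.prems in auto)
      then have "b \<notin> set (greedy_match C (d # ds))" unfolding eq by blast
      then show ?thesis using b eq unfolding i by (intro bexI[of _ b]) auto
    next
      case False
      \<comment> \<open>Now \<open>s\<close> and \<open>d\<close> compete for \<open>b\<close>: it
        is also the partner of \<open>d\<close> in the absence of \<open>s\<close>. The displacement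
        continues with \<open>d\<close>.\<close>
      have g: "greedy_match C (d # as) = b # greedy_match {c \<in> C. b < c} as" for as
      proof -
        have "(LEAST b. b \<in> C \<and> d \<le> b) = b"
          using b(1-3) False True by (intro Least_equality) auto
        then show ?thesis by (simp add: Let_def greedy_match.simps(2))
      qed
      have "finite {c \<in> C. b < c}" "dominates {c \<in> C. b < c} (insert d (set ds))"
        "sorted_wrt (<) ds" "d \<notin> set ds" using Cons.prems b(5) by auto
      from Cons.IH[OF this] obtain b' where b': "b' \<in> {c \<in> C. b < c} - set (greedy_match {c \<in> C. b < c} ds)" "d \<le> b'"
        "\<forall>c \<in> {c \<in> C. b < c} - set (greedy_match {c \<in> C. b < c} ds). d \<le> c \<longrightarrow> b' \<le> c"
        "set (greedy_match {c \<in> C. b < c} (insort d ds)) = insert b' (set (greedy_match {c \<in> C. b < c} ds))"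
        by blast
      have "insort d ds = d # ds" using Cons.prems(3) by (cases ds) auto
      then have set: "set (greedy_match C (insort s (d # ds))) = insert b' (set (greedy_match C (d # ds)))"
        using b' b(4) unfolding i g by auto
      have "b' \<le> c" if "c \<in> C - set (greedy_match C (d # ds))" "s \<le> c" for c
      proof -
        have "c \<noteq> b" "b \<le> c" using that b(3) unfolding g by auto
        then show ?thesis using b'(3) that False unfolding g by auto
      qed
      then show ?thesis
        using b' set b(2) True unfolding g[of ds] by (intro bexI[of _ b']) auto
    qed
  next
    case False
    with Cons.prems(4) have sd: "d < s" by simp
    then have i: "insort s (d # ds) = d # insort s ds" by simp
    have "sorted_wrt (<) (d # insort s ds)"
      using sorted_wrt_insort[OF Cons.prems(3,4)] unfolding i .
    moreover have "dominates C (set (d # insort s ds))"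
      using Cons.prems(2) by (simp add: set_insort_key insert_commute)
    ultimately obtain b where b: "b \<in> C" "d \<le> b" "\<And>c. c \<in> C \<Longrightarrow> d \<le> c \<Longrightarrow> b \<le> c"
      "\<And>as. greedy_match C (d # as) = b # greedy_match {c \<in> C. b < c} as"
      "dominates {c \<in> C. b < c} (set (insort s ds))"
      using greedy_match_Cons[OF Cons.prems(1)] by blast
    let ?C = "{c \<in> C. b < c}"
    have "finite ?C" "dominates ?C (insert s (set ds))" "sorted_wrt (<) ds" "s \<notin> set ds"
      using Cons.prems b(5) by (auto simp: set_insort_key)
    from Cons.IH[OF this] obtain b' where b': "b' \<in> ?C - set (greedy_match ?C ds)" "s \<le> b'"
      "\<forall>c \<in> ?C - set (greedy_match ?C ds). s \<le> c \<longrightarrow> b' \<le> c"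
      "set (greedy_match ?C (insort s ds)) = insert b' (set (greedy_match ?C ds))"
      by blast
    have "b' \<le> c" if "c \<in> C - set (greedy_match C (d # ds))" "s \<le> c" for c
    proof -
      have "c \<noteq> b" "b \<le> c" using that b(3) sd unfolding b(4) by auto
      then show ?thesis using b'(3) that unfolding b(4) by auto
    qed
    then show ?thesis using b' unfolding i b(4) by (intro bexI[of _ b']) auto
  qed
qed

lemma ltri_insert:
  assumes "finite C" "finite D" "s \<notin> D" "dominates C (insert s D)"
  obtains b where "b \<in> C - ltri C D" "s \<le> b" "\<And>c. c \<in> C - ltri C D \<Longrightarrow> s \<le> c \<Longrightarrow> b \<le> c"
    "ltri C (insert s D) = insert b (ltri C D)"
  using greedy_match_insort[of C s "sorted_list_of_set D"] assms
  by (auto simp: ltri_def sorted_list_of_set_insert)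

lemma ltri_empty [simp]: "ltri C {} = {}"
  by (simp add: ltri_def)

lemma ltri_subset: "finite C \<Longrightarrow> finite D \<Longrightarrow> dominates C D \<Longrightarrow> ltri C D \<subseteq> C"
  unfolding ltri_def by (intro greedy_match_subset) auto

lemma card_ltri:
  assumes "finite D" "finite C" "dominates C D"
  shows "card (ltri C D) = card D"
  using assms
proof (induction D)
  case (insert s D)
  have "dominates C D"
    using insert.prems insert.hyps by - (rule dominates_mono[of C "insert s D"], auto)
  moreover obtain b where "b \<in> C - ltri C D" "ltri C (insert s D) = insert b (ltri C D)"
    using ltri_insert[of C D s] insert by metis
  ultimately show ?case
    using insert ltri_subset[of C D] finite_subset[of "ltri C D" C] by simp
qed simp

text \<open>The elements of \<open>E - D\<close> are added one at a time; by
  \<open>ltri_insert\<close> each step contributes one element, at or above the one added.\<close>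

lemma ltri_mono:
  assumes "finite C" "finite E" "D \<subseteq> E" "dominates C E"
  shows "ltri C D \<subseteq> ltri C E \<and> (\<forall>e \<in> ltri C E - ltri C D. \<exists>x \<in> E - D. x \<le> e)"
proof -
  have "ltri C D \<subseteq> ltri C (D \<union> F) \<and> (\<forall>e \<in> ltri C (D \<union> F) - ltri C D. \<exists>x \<in> F. x \<le> e)"
    if "finite F" "finite D" "D \<inter> F = {}" "dominates C (D \<union> F)" for F
    using that
  proof (induction F)
    case (insert x F)
    have "dominates C (D \<union> F)"
      using insert.prems insert.hyps by - (rule dominates_mono[of C "D \<union> insert x F"], auto simp: assms)
    moreover obtain b where "x \<le> b" "ltri C (insert x (D \<union> F)) = insert b (ltri C (D \<union> F))"
    proof (rule ltri_insert[of C "D \<union> F" x])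
      show "finite C" "finite (D \<union> F)" "x \<notin> D \<union> F" "dominates C (insert x (D \<union> F))"
        using insert assms(1) by auto
    qed
    ultimately show ?case using insert by auto
  qed simp
  from this[of "E - D"] show ?thesis using assms by (auto simp: Un_absorb1 finite_subset)
qed

lemma ltri_cong:
  assumes "finite D" "\<forall>d\<in>D. v \<le> d" "{c \<in> C. v \<le> c} = {c \<in> C'. v \<le> c}"
  shows "ltri C D = ltri C' D"
  unfolding ltri_def using greedy_match_cong[of "sorted_list_of_set D" v C C'] assms by simp


section \<open>Iterated matching along a chain of columns\<close>

text \<open>Unlike \<open>rssyt\<close>, this permits an empty last column, as in
  \<open>take j T @ [column T j]\<close> with \<open>j\<close> past the tableau.\<close>

definition column_chain :: "tableau \<Rightarrow> bool" where
  "column_chain = successively (\<lambda>C D. dominates (set C) (set D))"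

lemma column_chain_Cons:
  "Cs \<noteq> [] \<Longrightarrow> column_chain (C # Cs) \<longleftrightarrow> dominates (set C) (set (hd Cs)) \<and> column_chain Cs"
  by (simp add: column_chain_def successively_Cons)

lemma ltri_columns_Cons:
  "Cs \<noteq> [] \<Longrightarrow> ltri_columns (C # Cs) = ltri (set C) (ltri_columns Cs)"
  by (cases Cs) auto

lemma ltri_columns_subset_card:
  assumes "column_chain Cs" "Cs \<noteq> []"
  shows "ltri_columns Cs \<subseteq> set (hd Cs) \<and> card (ltri_columns Cs) = card (set (last Cs))"
  using assms
proof (induction Cs)
  case (Cons C Cs)
  show ?case
  proof (cases "Cs = []")
    case False
    then have IH: "ltri_columns Cs \<subseteq> set (hd Cs)" "card (ltri_columns Cs) = card (set (last Cs))"
      and dom: "dominates (set C) (set (hd Cs))"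
      using Cons by (auto simp: column_chain_Cons)
    have fin: "finite (ltri_columns Cs)" using IH(1) finite_subset by blast
    have "dominates (set C) (ltri_columns Cs)"
      by (rule dominates_mono[OF dom]) (use IH in auto)
    then show ?thesis
      using False IH(2) ltri_subset[OF _ fin, of "set C"] card_ltri[OF fin, of "set C"]
      by (simp add: ltri_columns_Cons)
  qed simp
qed simp

lemma finite_ltri_columns: "column_chain Cs \<Longrightarrow> finite (ltri_columns Cs)"
  using ltri_columns_subset_card[of Cs] by (cases "Cs = []") (auto intro: finite_subset)

lemma dominates_ltri_columns:
  assumes "column_chain (C # Cs)" "Cs \<noteq> []"
  shows "dominates (set C) (ltri_columns Cs)"
proof -
  have dom: "dominates (set C) (set (hd Cs))" and "column_chain Cs"
    using assms by (auto simp: column_chain_Cons)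
  with assms(2) have "ltri_columns Cs \<subseteq> set (hd Cs)" using ltri_columns_subset_card by blast
  then show ?thesis using dominates_mono[OF dom subset_refl] by simp
qed

lemma column_chain_appendD: "column_chain (Cs @ Ds) \<Longrightarrow> column_chain Cs \<and> column_chain Ds"
  by (simp add: column_chain_def successively_append_iff)

lemma ltri_columns_snoc_subset:
  assumes "column_chain (Cs @ [D])" "Cs \<noteq> []"
  shows "ltri_columns (Cs @ [D]) \<subseteq> ltri_columns Cs"
  using assms
proof (induction Cs)
  case (Cons C Cs)
  show ?case
  proof (cases "Cs = []")
    case True
    then show ?thesis using Cons.prems ltri_columns_subset_card[of "[C, D]"] by simp
  next
    case False
    have ch: "column_chain (Cs @ [D])" "column_chain (C # Cs)" "column_chain Cs"
      using column_chain_appendD[of "[C]" "Cs @ [D]"] column_chain_appendD[of "C # Cs" "[D]"]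
        column_chain_appendD[of Cs "[D]"] Cons.prems(1) by auto
    have "ltri (set C) (ltri_columns (Cs @ [D])) \<subseteq> ltri (set C) (ltri_columns Cs)"
      using ltri_mono[OF _ finite_ltri_columns[OF ch(3)] Cons.IH[OF ch(1) False], of "set C"]
        dominates_ltri_columns[OF ch(2) False] by simp
    then show ?thesis using False by (simp add: ltri_columns_Cons)
  qed
qed simp

text \<open>Minimality of \<open>b\<close> in the difference of neighbouring key columns is what
  carries the induction. After one more \<open>ltri\<close>, every element of the difference lies
  above some element of the previous difference, hence above \<open>b\<close>, and so competes in
  the exchange property. For a single column, minimality comes from \<open>k\<close> being at most
  every entry.\<close>

lemma ltri_columns_snoc_insert:
  assumes "column_chain (Cs @ [D])" "column_chain (Cs @ [D'])" "Cs \<noteq> []"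
    and "set D' = insert k (set D)" "k \<notin> set D" "\<forall>C\<in>set Cs. \<forall>c\<in>set C. k \<le> c"
  shows "\<exists>b \<in> ltri_columns Cs - ltri_columns (Cs @ [D]).
    (\<forall>c \<in> ltri_columns Cs - ltri_columns (Cs @ [D]). b \<le> c) \<and>
    ltri_columns (Cs @ [D']) = insert b (ltri_columns (Cs @ [D]))"
  using assms
proof (induction Cs)
  case (Cons C Cs)
  show ?case
  proof (cases "Cs = []")
    case True
    have "dominates (set C) (insert k (set D))"
      using Cons.prems(2,4) True by (simp add: column_chain_Cons)
    then obtain b where "b \<in> set C - ltri (set C) (set D)"
      "\<And>c. c \<in> set C - ltri (set C) (set D) \<Longrightarrow> k \<le> c \<Longrightarrow> b \<le> c"
      "ltri (set C) (insert k (set D)) = insert b (ltri (set C) (set D))"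
      using ltri_insert[OF List.finite_set List.finite_set Cons.prems(5)] by blast
    then show ?thesis using True Cons.prems(4,6) by (intro bexI[of _ b]) auto
  next
    case False
    have ch: "column_chain (Cs @ [D])" "column_chain (Cs @ [D'])" "column_chain (C # Cs)" "column_chain Cs"
      using column_chain_appendD[of "[C]" "Cs @ [D]"] column_chain_appendD[of "[C]" "Cs @ [D']"]
        column_chain_appendD[of "C # Cs" "[D]"] column_chain_appendD[of Cs "[D]"] Cons.prems(1,2) by auto
    let ?X = "ltri_columns Cs" and ?Y = "ltri_columns (Cs @ [D])" and ?Y' = "ltri_columns (Cs @ [D'])"
    have "\<forall>C\<in>set Cs. \<forall>c\<in>set C. k \<le> c" using Cons.prems(6) by simp
    from Cons.IH[OF ch(1,2) False Cons.prems(4,5) this]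
    obtain b where b: "b \<in> ?X - ?Y" "\<forall>c \<in> ?X - ?Y. b \<le> c" "?Y' = insert b ?Y"
      by blast
    have fin: "finite ?X" "finite ?Y" using finite_ltri_columns ch by auto
    have sub: "?Y' \<subseteq> ?X" "?Y \<subseteq> ?X"
      using ltri_columns_snoc_subset ch False by auto
    have dom: "dominates (set C) ?X" using dominates_ltri_columns[OF ch(3) False] .
    have "dominates (set C) (insert b ?Y)"
      by (rule dominates_mono[OF dom]) (use sub b fin in auto)
    then obtain b' where b': "b' \<in> set C - ltri (set C) ?Y" "b \<le> b'"
      "\<And>c. c \<in> set C - ltri (set C) ?Y \<Longrightarrow> b \<le> c \<Longrightarrow> b' \<le> c"
      "ltri (set C) (insert b ?Y) = insert b' (ltri (set C) ?Y)"
      using ltri_insert[OF List.finite_set fin(2)] b(1) by blast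
    have "b' \<in> ltri (set C) ?X"
      using ltri_mono[OF List.finite_set fin(1) sub(1) dom] unfolding b(3) b'(4) by blast
    moreover have "b' \<le> c" if c: "c \<in> ltri (set C) ?X - ltri (set C) ?Y" for c
    proof -
      obtain e where e: "e \<in> ?X - ?Y" "e \<le> c"
        using bspec[OF conjunct2[OF ltri_mono[OF List.finite_set fin(1) sub(2) dom]] c] by blast
      have "b \<le> c" using bspec[OF b(2) e(1)] e(2) by (rule order_trans)
      moreover have "c \<in> set C" using ltri_subset[OF List.finite_set fin(1) dom] c by blast
      ultimately show ?thesis using b'(3)[of c] c by simp
    qed
    ultimately have "\<exists>b \<in> ltri (set C) ?X - ltri (set C) ?Y.
        (\<forall>c \<in> ltri (set C) ?X - ltri (set C) ?Y. b \<le> c) \<and>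
        ltri (set C) ?Y' = insert b (ltri (set C) ?Y)"
      using b'(1) unfolding b(3) b'(4) by blast
    then show ?thesis using False by (simp add: ltri_columns_Cons)
  qed
qed simp

lemma ltri_columns_append_cong:
  assumes "Bs \<noteq> []" "ltri (set C) (ltri_columns Bs) = ltri (set C') (ltri_columns Bs)"
  shows "ltri_columns (As @ C # Bs) = ltri_columns (As @ C' # Bs)"
  by (induction As) (simp_all add: ltri_columns_Cons assms)

lemma column_chain_rssyt: "rssyt T \<Longrightarrow> column_chain T"
proof (induction T)
  case (Cons C Cs)
  then show ?case
    by (cases Cs) (auto simp: rssyt_Cons column_chain_Cons column_chain_def)
qed (simp add: column_chain_def)

lemma column_chain_take:
  assumes "rssyt T"
  shows "column_chain (take j T @ [column T j])"
proof (cases "j < length T")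
  case True
  then have "take j T @ [column T j] = take (Suc j) T" by (simp add: column_def take_Suc_conv_app_nth)
  then show ?thesis
    using column_chain_appendD[of "take (Suc j) T" "drop (Suc j) T"] column_chain_rssyt[OF assms] by simp
next
  case False
  then show ?thesis
    using column_chain_rssyt[OF assms] by (simp add: column_def column_chain_def successively_append_iff)
qed

text \<open>With empty columns allowed, both keys have an (empty) column at every index beyond the tableau.\<close>

definition left_key_column :: "tableau \<Rightarrow> nat \<Rightarrow> nat set" where
  "left_key_column Q j = ltri_columns (take j Q @ [column Q j])"

lemma left_key_column_eq_take: "j < length Q \<Longrightarrow> left_key_column Q j = ltri_columns (take (Suc j) Q)"
  by (simp add: left_key_column_def column_def take_Suc_conv_app_nth)

lemma finite_left_key_column: "rssyt Q \<Longrightarrow> finite (left_key_column Q j)"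
  unfolding left_key_column_def by (intro finite_ltri_columns column_chain_take)

lemma card_left_key_column: "rssyt Q \<Longrightarrow> card (left_key_column Q j) = card (set (column Q j))"
  using ltri_columns_subset_card[OF column_chain_take] unfolding left_key_column_def by simp

lemma left_key_column_out: "rssyt Q \<Longrightarrow> length Q \<le> j \<Longrightarrow> left_key_column Q j = {}"
  using card_left_key_column[of Q j] finite_left_key_column[of Q j] by (simp add: column_def)

lemma left_key_column_Suc:
  assumes "rssyt Q"
  shows "left_key_column Q (Suc j) \<subseteq> left_key_column Q j"
proof (cases "j < length Q")
  case True
  then have "take (Suc j) Q \<noteq> []" by auto
  then show ?thesis
    using ltri_columns_snoc_subset[OF column_chain_take[OF assms, of "Suc j"]]
    unfolding left_key_column_eq_take[OF True] by (simp add: left_key_column_def)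
qed (simp add: left_key_column_out assms)

lemma column_append_to_column:
  assumes "c \<le> length Q"
  shows "column (append_to_column c k Q) j = (if j = c then column Q c @ [k] else column Q j)"
  using assms by (auto simp: append_to_column_def column_def nth_append)

lemma take_append_to_column:
  assumes "c \<le> length Q" "j \<le> c"
  shows "take j (append_to_column c k Q) = take j Q"
  using assms by (auto simp: append_to_column_def)

lemma left_key_column_append_less:
  assumes "c \<le> length Q" "j < c"
  shows "left_key_column (append_to_column c k Q) j = left_key_column Q j"
  using assms by (simp add: left_key_column_def column_append_to_column take_append_to_column)

text \<open>All entries right of column \<open>c\<close> exceed \<open>k\<close>, and matching them
  never inspects elements of column \<open>c\<close> below them, so the added \<open>k\<close> is
  not seen.\<close>

lemma left_key_column_append_greater:
  assumes "rssyt Q" "rssyt (append_to_column c k Q)" "c < j"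
    and "\<forall>i > c. \<forall>e\<in>set (column Q i). k < e" "c \<le> length Q" "k \<notin> set (column Q c)"
  shows "left_key_column (append_to_column c k Q) j = left_key_column Q j"
proof (cases "j < length Q")
  case True
  define Bs where "Bs = take (j - Suc c) (drop (Suc c) Q) @ [column Q j]"
  have c: "c < length Q" using True assms(3) by simp
  have q: "append_to_column c k Q = Q[c := Q ! c @ [k]]" using c by (simp add: append_to_column_def)
  have split: "take j (Q[c := C]) = take c Q @ C # take (j - Suc c) (drop (Suc c) Q)" for C
  proof -
    have "Q[c := C] = take c Q @ C # drop (Suc c) Q" using c by (rule upd_conv_take_nth_drop)
    moreover have "take j (take c Q @ C # drop (Suc c) Q) = take c Q @ C # take (j - Suc c) (drop (Suc c) Q)"
      using c assms(3) by (simp add: take_Cons' min_def)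
    ultimately show ?thesis by simp
  qed
  have t: "take j Q @ [column Q j] = take c Q @ Q ! c # Bs"
    using split[of "Q ! c"] by (simp add: Bs_def)
  have t': "take j (append_to_column c k Q) @ [column (append_to_column c k Q) j] =
      take c Q @ (Q ! c @ [k]) # Bs"
    using split[of "Q ! c @ [k]"] assms(3,5)
    by (simp only: column_append_to_column) (simp add: q Bs_def)
  have "column_chain Bs"
    using column_chain_take[OF assms(1), of j] column_chain_appendD[of "take c Q @ [Q ! c]" Bs]
    unfolding t by simp
  moreover have "hd Bs = column Q (Suc c)"
    using True assms(3) by (cases "j = Suc c") (auto simp: Bs_def hd_drop_conv_nth column_def hd_append)
  moreover have Bs: "Bs \<noteq> []" by (simp add: Bs_def)
  ultimately have sub: "ltri_columns Bs \<subseteq> set (column Q (Suc c))"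
    using ltri_columns_subset_card[of Bs] by simp
  then have "\<forall>d\<in>ltri_columns Bs. Suc k \<le> d" using assms(4) sub by (metis Suc_leI lessI subsetD)
  then have "ltri (set (Q ! c @ [k])) (ltri_columns Bs) = ltri (set (Q ! c)) (ltri_columns Bs)"
    using finite_subset[OF sub] by (intro ltri_cong[of _ "Suc k"]) auto
  then show ?thesis
    unfolding left_key_column_def t t' by (rule ltri_columns_append_cong[OF Bs])
next
  case False
  then have "length (append_to_column c k Q) \<le> j" using assms(3) by (auto simp: append_to_column_def)
  then show ?thesis using False assms by (simp add: left_key_column_out)
qed

lemma left_key_column_append_0:
  "left_key_column (append_to_column 0 k Q) 0 = insert k (left_key_column Q 0)"
  by (auto simp: left_key_column_def append_to_column_def column_def)

lemma left_key_column_append_Suc: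
  assumes "rssyt Q" "rssyt (append_to_column (Suc c) k Q)" "Suc c \<le> length Q"
    and "\<forall>C\<in>set Q. \<forall>e\<in>set C. k \<le> e" "k \<notin> set (column Q (Suc c))"
  obtains b where "b \<in> left_key_column Q c - left_key_column Q (Suc c)"
    "\<forall>e \<in> left_key_column Q c - left_key_column Q (Suc c). b \<le> e"
    "left_key_column (append_to_column (Suc c) k Q) (Suc c) = insert b (left_key_column Q (Suc c))"
proof -
  have 1: "left_key_column (append_to_column (Suc c) k Q) (Suc c) =
      ltri_columns (take (Suc c) Q @ [column Q (Suc c) @ [k]])"
    unfolding left_key_column_def column_append_to_column[OF assms(3)]
    using take_append_to_column[OF assms(3)] by simp
  have 2: "left_key_column Q c = ltri_columns (take (Suc c) Q)"
    using assms(3) by (simp add: left_key_column_eq_take)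
  have "column_chain (take (Suc c) Q @ [column Q (Suc c) @ [k]])"
    using column_chain_take[OF assms(2), of "Suc c"] take_append_to_column[OF assms(3)]
    by (simp add: column_append_to_column[OF assms(3)])
  moreover have "\<forall>C\<in>set (take (Suc c) Q). \<forall>e\<in>set C. k \<le> e" using assms(4) in_set_takeD by metis
  moreover have "take (Suc c) Q \<noteq> []" using assms(3) by auto
  ultimately have "\<exists>b \<in> left_key_column Q c - left_key_column Q (Suc c).
    (\<forall>e \<in> left_key_column Q c - left_key_column Q (Suc c). b \<le> e) \<and>
    left_key_column (append_to_column (Suc c) k Q) (Suc c) = insert b (left_key_column Q (Suc c))"
    unfolding 1 2 left_key_column_def[of Q "Suc c"]
    using column_chain_take[OF assms(1), of "Suc c"] assms(5)
    by (intro ltri_columns_snoc_insert[where k = k]) auto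
  then show thesis using that by blast
qed


subsection \<open>Keys along one insertion step\<close>

lemma distinct_column: "rssyt T \<Longrightarrow> distinct (column T j)"
  using sorted_column[of T j] strict_sorted_iff[of "rev (column T j)"] by (simp add: sorted_wrt_rev)

lemma length_column_shape: "shape P = shape Q \<Longrightarrow> length (column P j) = length (column Q j)"
  using map_eq_imp_length_eq[of length P length Q] unfolding shape_def column_def
  by (auto dest!: arg_cong[of _ _ "\<lambda>l. l ! j"])

lemma card_key_columns:
  assumes "rssyt P" "rssyt Q" "shape P = shape Q"
  shows "card (right_key_column P j) = card (left_key_column Q j)"
  using assms length_column_shape[OF assms(3)] distinct_column
  by (simp add: card_right_key_column card_left_key_column distinct_card)

text \<open>Old from new is immediate for \<open>v\<close> above \<open>t\<close>: the right count
  drops by one, the left by at most one. New from old is immediate for \<open>v\<close> above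
  \<open>s\<close>, symmetrically. Otherwise a neighbouring column is used.\<close>

lemma key_columns_step:
  assumes P: "rssyt P" "rssyt P'" "column_insert x P = (P', c)"
    and Q: "rssyt Q" "rssyt Q'" "Q' = append_to_column c k Q" "c \<le> length Q"
    and shape: "shape P = shape Q" "shape P' = shape Q'"
    and k: "\<forall>C\<in>set Q. \<forall>e\<in>set C. k \<le> e" "\<forall>j \<ge> c. k \<notin> set (column Q j)"
  shows "(\<forall>j. dominates (right_key_column P' j) (left_key_column Q' j)) \<longleftrightarrow>
    (\<forall>j. dominates (right_key_column P j) (left_key_column Q j)) \<and> k \<le> x"
proof -
  let ?r = "right_key_column P" and ?r' = "right_key_column P'"
  let ?l = "left_key_column Q" and ?l' = "left_key_column Q'"
  define N where "N S v = card {a \<in> S. a < v}" for S :: "nat set" and v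
  have N_mono: "N S v \<le> N T v" if "{a \<in> S. a < v} \<subseteq> T" "finite T" for S T v
    unfolding N_def by (rule card_mono) (use that in auto)
  have N_insert: "N (insert a S) v = N S v + (if a < v then 1 else 0)" if "finite S" "a \<notin> S" for a S v
    using card_Collect_insert[OF that, of "\<lambda>e. e < v"] by (simp add: N_def)
  have fin [simp]: "finite (?r j)" "finite (?r' j)" "finite (?l j)" "finite (?l' j)" for j
    using finite_left_key_column Q(1,2) by simp_all
  have dom: "dominates (?r j) (?l j) \<longleftrightarrow> (\<forall>v. N (?r j) v \<le> N (?l j) v)" for j
    unfolding N_def by (intro dominates_iff_less card_key_columns P Q shape) simp_all
  have dom': "dominates (?r' j) (?l' j) \<longleftrightarrow> (\<forall>v. N (?r' j) v \<le> N (?l' j) v)" for j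
    unfolding N_def by (intro dominates_iff_less card_key_columns P Q shape) simp_all
  obtain t where t: "?r' c = insert t (?r c)" "t \<notin> ?r c"
    "\<And>e. e \<in> ?r c \<Longrightarrow> e < t \<Longrightarrow> e \<in> ?r (Suc c)" "c = 0 \<Longrightarrow> x \<le> t"
    using right_key_column_insert_eq[OF P(1,3,2)] by blast
  have k_col: "k \<le> e" if "e \<in> set (column Q j)" for e j
    using k(1) that by (auto simp: column_def split: if_splits)
  have k_less: "\<forall>i>c. \<forall>e\<in>set (column Q i). k < e"
  proof (intro allI impI ballI)
    fix i e assume "c < i" "e \<in> set (column Q i)"
    moreover from this have "e \<noteq> k" using k(2) by (metis less_imp_le)
    ultimately show "k < e" using k_col[of e i] by simp
  qed
  have r_other: "?r' j = ?r j" if "j \<noteq> c" for j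
    using right_key_column_insert_neq[OF P(1,3,2) that] .
  have l_other: "?l' j = ?l j" if "j \<noteq> c" for j
  proof (cases "j < c")
    case True
    then show ?thesis unfolding Q(3) by (rule left_key_column_append_less[OF Q(4)])
  next
    case False
    then have "c < j" using that by simp
    then show ?thesis
      unfolding Q(3) using left_key_column_append_greater[OF Q(1) Q(2)[unfolded Q(3)] _ k_less Q(4)] k(2)
      by simp
  qed
  obtain s where s: "?l' c = insert s (?l c)" "s \<notin> ?l c" "c = 0 \<Longrightarrow> s = k"
    "\<And>c' e. c = Suc c' \<Longrightarrow> e \<in> ?l c' \<Longrightarrow> e < s \<Longrightarrow> e \<in> ?l c"
  proof (cases c)
    case 0
    have "k \<notin> ?l 0" using k(2) unfolding 0 by (simp add: left_key_column_def)
    then show thesis using that[of k] left_key_column_append_0[of k Q] 0 Q(3) by simp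
  next
    case (Suc c')
    obtain b where b: "b \<in> ?l c' - ?l c" "\<forall>e \<in> ?l c' - ?l c. b \<le> e" "?l' c = insert b (?l c)"
      using left_key_column_append_Suc[OF Q(1) _ _ k(1)] Q(2-4) k(2) unfolding Suc by blast
    have "e \<in> ?l c" if "e \<in> ?l c'" "e < b" for e using b(2) that by (meson DiffI not_le)
    with b Suc show thesis by (intro that[of b]) auto
  qed
  have r_sub: "?r' c \<subseteq> ?r c'" if "c = Suc c'" for c'
    using right_key_column_Suc[of P' c'] r_other[of c'] that by simp
  have l0: "\<forall>e \<in> ?l' 0. k \<le> e"
    using k_col column_append_to_column[OF Q(4), of k 0] Q(3) by (auto simp: left_key_column_def)
  show ?thesis
  proof
    assume L: "\<forall>j. dominates (?r' j) (?l' j)"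
    have "k \<le> x"
    proof -
      \<comment> \<open>An element at most \<open>x\<close> in the first right key column forces one
        in the first left key column, whose elements are all at least \<open>k\<close>.\<close>
      obtain e where e: "e \<in> ?r' 0" "e \<le> x" using right_key_column_lower[OF P(1,3)] by blast
      have "0 < N (?r' 0) (Suc e)" using e by (auto simp: N_def card_gt_0_iff)
      then have "0 < N (?l' 0) (Suc e)" using L dom'[of 0] by (metis order_less_le_trans)
      then obtain b where "b \<in> ?l' 0" "b \<le> e" by (auto simp: N_def card_gt_0_iff)
      then show ?thesis using l0 e(2) by fastforce
    qed
    moreover have "dominates (?r c) (?l c)"
      unfolding dom
    proof
      fix v
      show "N (?r c) v \<le> N (?l c) v"
      proof (cases "t < v")
        case True
        then have "N (?r c) v + 1 = N (?r' c) v" using N_insert[OF _ t(2)] t(1) by simp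
        also have "\<dots> \<le> N (?l' c) v" using L dom' by blast
        also have "\<dots> \<le> N (?l c) v + 1" using N_insert[OF _ s(2)] s(1) by simp
        finally show ?thesis by simp
      next
        case False
        \<comment> \<open>Up to \<open>t\<close>, column \<open>c\<close> of the right key lies in
          column \<open>c + 1\<close>, where both keys are unchanged; the left key columns are
          nested.\<close>
        have "N (?r c) v \<le> N (?r (Suc c)) v" by (rule N_mono) (use t(3) False in auto)
        also have "\<dots> = N (?r' (Suc c)) v" using r_other by simp
        also have "\<dots> \<le> N (?l' (Suc c)) v" using L dom' by blast
        also have "\<dots> \<le> N (?l c) v"
          using left_key_column_Suc[OF Q(1), of c] l_other[of "Suc c"] by (intro N_mono) auto
        finally show ?thesis .
      qed
    qed
    moreover have "dominates (?r j) (?l j)" if "j \<noteq> c" for j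
      using L[rule_format, of j] unfolding r_other[OF that] l_other[OF that] .
    ultimately show "(\<forall>j. dominates (?r j) (?l j)) \<and> k \<le> x" by metis
  next
    assume R: "(\<forall>j. dominates (?r j) (?l j)) \<and> k \<le> x"
    have "dominates (?r' c) (?l' c)"
      unfolding dom'
    proof
      fix v
      show "N (?r' c) v \<le> N (?l' c) v"
      proof (cases "s < v")
        case True
        have "N (?r' c) v \<le> N (?r c) v + 1" using N_insert[OF _ t(2)] t(1) by simp
        also have "\<dots> \<le> N (?l c) v + 1" using R dom by simp
        also have "\<dots> = N (?l' c) v" using N_insert[OF _ s(2)] s(1) True by simp
        finally show ?thesis .
      next
        case False
        show ?thesis
        proof (cases c)
          case 0
          \<comment> \<open>Here \<open>s = k\<close>. The left key has nothing below
            \<open>v\<close>, hence neither has the old right key, and the new element satisfies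
            \<open>t >= x >= k\<close>.\<close>
          have "v \<le> k" using False s(3)[OF 0] by simp
          have "k \<le> e" if "e \<in> ?l c" for e using l0 s(1) 0 that by simp
          then have "{a \<in> ?l c. a < v} = {}" using \<open>v \<le> k\<close> by fastforce
          then have "N (?l c) v = 0" by (simp add: N_def)
          moreover have "N (?r c) v \<le> N (?l c) v" using R dom by blast
          ultimately have "N (?r c) v = 0" by simp
          moreover have "\<not> t < v" using t(4)[OF 0] R \<open>v \<le> k\<close> by simp
          ultimately show ?thesis using N_insert[OF _ t(2)] t(1) by simp
        next
          case (Suc c')
          \<comment> \<open>The detour to the left: the new right key columns are nested, and up to
            \<open>s\<close> column \<open>c'\<close> of the left key lies in column
            \<open>c\<close>.\<close>
          have "N (?r' c) v \<le> N (?r c') v" using r_sub[OF Suc] by (intro N_mono) auto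
          also have "\<dots> \<le> N (?l c') v" using R dom by blast
          also have "\<dots> \<le> N (?l' c) v" by (rule N_mono) (use s(1) s(4)[OF Suc] False in auto)
          finally show ?thesis .
        qed
      qed
    qed
    moreover have "dominates (?r' j) (?l' j)" if "j \<noteq> c" for j
      using R unfolding r_other[OF that] l_other[OF that] by blast
    ultimately show "\<forall>j. dominates (?r' j) (?l' j)" by metis
  qed
qed

lemma column_of_set:
  assumes "finite S"
  shows "set (column_of_set S) = S" "sorted_wrt (>) (column_of_set S)" "length (column_of_set S) = card S"
  using assms by (simp_all add: column_of_set_def sorted_wrt_rev)

text \<open>Equal column sizes turn entrywise comparison into dominance; past the tableaux the left
  key is empty and dominance is automatic, so \<open>j\<close> may be unbounded.\<close>

lemma tableau_ge_keys_iff: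
  assumes "rssyt P" "rssyt Q" "shape P = shape Q"
  shows "tableau_ge (right_key P) (left_key Q) \<longleftrightarrow>
    (\<forall>j. dominates (right_key_column P j) (left_key_column Q j))"
proof -
  have len: "length P = length Q" using assms(3) unfolding shape_def by (rule map_eq_imp_length_eq)
  have col: "list_all2 (\<ge>) (column_of_set (right_key_column P j)) (column_of_set (left_key_column Q j)) \<longleftrightarrow>
      dominates (right_key_column P j) (left_key_column Q j)" for j
  proof -
    let ?A = "right_key_column P j" and ?B = "left_key_column Q j"
    have f: "finite ?A" "finite ?B" using finite_left_key_column[OF assms(2)] by simp_all
    show ?thesis
      using dominates_iff_nth[OF column_of_set(2)[OF f(1)] column_of_set(2)[OF f(2)]]
        card_key_columns[OF assms, of j]
      by (simp add: column_of_set f list_all2_conv_all_nth)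
  qed
  have "tableau_ge (right_key P) (left_key Q) \<longleftrightarrow>
      (\<forall>j < length Q. dominates (right_key_column P j) (left_key_column Q j))"
    unfolding tableau_ge_def list_all2_conv_all_nth[of "list_all2 (\<ge>)"] col[symmetric]
    by (simp add: right_key_def left_key_def len right_key_column_def left_key_column_eq_take)
  also have "\<dots> \<longleftrightarrow> (\<forall>j. dominates (right_key_column P j) (left_key_column Q j))"
    using left_key_column_out[OF assms(2)] by (metis dominates_empty not_le)
  finally show ?thesis .
qed


subsection \<open>Inverting column insertion\<close>

text \<open>The data that undo a bump. With \<open>y\<close> the displaced letter, no old entry lies
  strictly above \<open>y\<close> and at most at \<open>x\<close>, so \<open>x\<close> is the least
  new entry at or above \<open>y\<close>.\<close>

lemma bump_least:
  assumes "\<not> (\<forall>y\<in>set C. x < y)"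
  shows "x \<in> set (bump C x)" "bumped (set C) x \<le> x"
    "z \<in> set (bump C x) \<Longrightarrow> bumped (set C) x \<le> z \<Longrightarrow> x \<le> z"
    "set C = insert (bumped (set C) x) (set (bump C x) - {x})"
proof -
  note b = bumped[OF List.finite_set assms]
  have s: "set (bump C x) = insert x (set C - {bumped (set C) x})"
    using set_bump[OF assms] assms by (simp add: insert_into_column_def)
  show "x \<in> set (bump C x)" "bumped (set C) x \<le> x" using s b by auto
  show "z \<in> set (bump C x) \<Longrightarrow> bumped (set C) x \<le> z \<Longrightarrow> x \<le> z"
    using b(3)[of z] unfolding s by (cases "z \<le> x") auto
  have "x \<in> set C \<Longrightarrow> x = bumped (set C) x" using b(2) b(3)[of x] by simp
  then show "set C = insert (bumped (set C) x) (set (bump C x) - {x})"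
    unfolding s using b(1) by auto
qed

lemma sorted_greater_unique:
  fixes C D :: "nat list"
  assumes "sorted_wrt (>) C" "sorted_wrt (>) D" "set C = set D"
  shows "C = D"
proof -
  have "rev C = rev D"
    by (rule strict_sorted_equal) (use assms in \<open>simp_all add: sorted_wrt_rev\<close>)
  then show ?thesis by simp
qed

text \<open>The index \<open>c\<close> tells where the insertion stopped; from there
  \<open>bump_least\<close> recovers the letters and columns from right to left.\<close>

lemma column_insert_inject:
  assumes "rssyt T" "rssyt T2" "column_insert x T = (T', c)" "column_insert x2 T2 = (T', c)"
  shows "x = x2 \<and> T = T2"
  using assms
proof (induction T arbitrary: T2 x x2 T' c)
  case Nil
  then have T': "column_insert x2 T2 = ([[x]], 0)" by simp
  then show ?case
  proof (cases T2)
    case (Cons D Ds)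
    then have "D \<noteq> []" using Nil.prems(2) by (simp add: rssyt_Cons)
    moreover have "\<forall>y\<in>set D. x2 < y"
      using column_insert_index_eq_0[of x2 T2] T' Cons by simp
    ultimately show ?thesis using T' Cons by (simp add: column_insert_append)
  qed simp
next
  case (Cons C Cs)
  have C: "C \<noteq> []" "sorted_wrt (>) C" "rssyt Cs" using Cons.prems(1) by (simp_all add: rssyt_Cons)
  show ?case
  proof (cases "\<forall>y\<in>set C. x < y")
    case True
    then have T': "T' = (C @ [x]) # Cs" "c = 0" using Cons.prems(3) by (simp_all add: column_insert_append)
    with C(1) obtain D Ds where T2: "T2 = D # Ds" using Cons.prems(4) by (cases T2) auto
    have "\<forall>y\<in>set D. x2 < y"
      using column_insert_index_eq_0[of x2 T2] T'(2) Cons.prems(4) T2 by simp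
    then show ?thesis using T' Cons.prems(4) T2 by (simp add: column_insert_append)
  next
    case False
    then have T': "T' = bump C x # fst (column_insert (bumped (set C) x) Cs)"
      "c = Suc (snd (column_insert (bumped (set C) x) Cs))"
      using Cons.prems(3) by (simp_all add: column_insert_bump)
    obtain D Ds where T2: "T2 = D # Ds" using Cons.prems(4) T'(2) by (cases T2) auto
    have D: "sorted_wrt (>) D" "rssyt Ds" using Cons.prems(2) T2 by (simp_all add: rssyt_Cons)
    have F2: "\<not> (\<forall>y\<in>set D. x2 < y)"
      using column_insert_index_eq_0[of x2 T2] T'(2) Cons.prems(4) T2 by simp
    then have e: "bump C x = bump D x2"
      "column_insert (bumped (set C) x) Cs = column_insert (bumped (set D) x2) Ds"
      using T' Cons.prems(4) T2 by (auto simp: column_insert_bump prod_eq_iff)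
    have IH: "bumped (set C) x = bumped (set D) x2 \<and> Cs = Ds"
      by (rule Cons.IH[OF C(3) D(2), of _ "fst (column_insert (bumped (set C) x) Cs)"
            "snd (column_insert (bumped (set C) x) Cs)"]) (simp_all add: e(2))
    note b = bump_least[OF False] and b2 = bump_least[OF F2]
    have "x \<le> x2" using b(3)[of x2] b2(1,2) IH e(1) by simp
    moreover have "x2 \<le> x" using b2(3)[of x] b(1,2) IH e(1) by simp
    ultimately have "x = x2" by simp
    moreover have "C = D"
      by (rule sorted_greater_unique[OF C(2) D(1)]) (use b(4) b2(4) IH e(1) \<open>x = x2\<close> in simp)
    ultimately show ?thesis using IH T2 by simp
  qed
qed

lemma rssyt_butlast_Cons:
  assumes "rssyt (C # Cs)" "Cs \<noteq> [] \<Longrightarrow> length (hd Cs) < length C" "butlast C \<noteq> []"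
  shows "rssyt (butlast C # Cs)"
proof -
  have C: "sorted_wrt (>) C" "\<forall>x\<in>set C. 0 < x" "rssyt Cs" "dominates (set C) (first_column Cs)"
    using assms(1) by (simp_all add: rssyt_Cons)
  have s: "sorted_wrt (>) (butlast C)" using C(1) by (simp add: butlast_conv_take sorted_wrt_take)
  have "dominates (set (butlast C)) (first_column Cs)"
  proof (cases Cs)
    case (Cons D Ds)
    then have D: "sorted_wrt (>) D" using C(3) by (simp add: rssyt_Cons)
    show ?thesis
      using dominates_iff_nth[OF C(1) D] dominates_iff_nth[OF s D] C(4) assms(2) Cons
      by (auto simp: nth_butlast)
  qed simp
  then show ?thesis using s C assms(3) by (auto simp: rssyt_Cons dest: in_set_butlastD)
qed

lemma corner_Cons_butlast_empty:
  assumes "rssyt (C # Cs)" "Cs \<noteq> [] \<Longrightarrow> length (hd Cs) < length C" "butlast C = []"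
  shows "C = [last C]" "Cs = []"
proof -
  have "C \<noteq> []" using assms(1) by (simp add: rssyt_Cons)
  then show C: "C = [last C]" using append_butlast_last_id[of C] assms(3) by simp
  show "Cs = []"
  proof (rule ccontr)
    assume "Cs \<noteq> []"
    moreover from this have "hd Cs = []" using assms(2) C by (metis length_0_conv length_Cons less_Suc0 list.size(3))
    ultimately show False using assms(1) by (cases Cs) (auto simp: rssyt_Cons)
  qed
qed

text \<open>The mirror image of \<open>dominates_insert_into_column\<close>. Counts for
  \<open>C'\<close> drop only for \<open>y < v <= x\<close>. There the next column contains
  \<open>y\<close>, counted at \<open>y\<close> but not at \<open>v\<close>, while \<open>C'\<close>
  has no element in \<open>[y, v)\<close>; this leaves the needed slack.\<close>

lemma dominates_reverse_insert:
  assumes "finite C'" "finite D" "dominates C' (insert_into_column D y)"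
    and "x \<in> C'" "y \<le> x" "\<And>z. z \<in> C' \<Longrightarrow> y \<le> z \<Longrightarrow> x \<le> z"
  shows "dominates (insert y (C' - {x})) D"
  unfolding dominates_def
proof
  fix v
  let ?D' = "insert_into_column D y" and ?C = "insert y (C' - {x})"
  have D': "card {e \<in> D. v \<le> e} \<le> card {e \<in> ?D'. v \<le> e}"
    using card_insert_into_column[OF assms(2), of y v] by simp
  have y: "y \<notin> C' - {x}" using assms(5,6) by force
  have C: "card {e \<in> C'. v \<le> e} = (if v \<le> x then 1 else 0) + card {e \<in> C' - {x}. v \<le> e}"
    using card_Collect_remove[OF assms(1,4)] .
  have C': "card {e \<in> ?C. v \<le> e} = (if v \<le> y then 1 else 0) + card {e \<in> C' - {x}. v \<le> e}"
    using card_Collect_insert[OF _ y] assms(1) by simp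
  show "card {e \<in> D. v \<le> e} \<le> card {e \<in> ?C. v \<le> e}"
  proof (cases "y < v \<and> v \<le> x")
    case True
    have "card {e \<in> D. v \<le> e} < card {e \<in> ?D'. y \<le> e}"
    proof (rule order.strict_trans1[OF D' psubset_card_mono])
      have "y \<in> {e \<in> ?D'. y \<le> e} - {e \<in> ?D'. v \<le> e}"
        using True by (simp add: insert_into_column_def)
      moreover have "{e \<in> ?D'. v \<le> e} \<subseteq> {e \<in> ?D'. y \<le> e}" using True by auto
      ultimately show "{e \<in> ?D'. v \<le> e} \<subset> {e \<in> ?D'. y \<le> e}" by blast
    qed (use assms(2) in simp)
    also have "\<dots> \<le> card {e \<in> C'. y \<le> e}" using assms(3) unfolding dominates_def by blast
    also have "{e \<in> C'. y \<le> e} = {e \<in> C'. v \<le> e}" using True assms(6) by fastforce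
    finally show ?thesis using C C' True by simp
  next
    case False
    have "card {e \<in> D. v \<le> e} \<le> card {e \<in> C'. v \<le> e}"
      using D' assms(3) unfolding dominates_def by (meson le_trans)
    then show ?thesis using C C' False assms(5) by (auto split: if_splits)
  qed
qed

lemma column_insert_surj:
  assumes "rssyt T'" "c < length T'" "Suc c < length T' \<Longrightarrow> length (T' ! Suc c) < length (T' ! c)"
  shows "\<exists>x T. 0 < x \<and> rssyt T \<and> column_insert x T = (T', c)"
  using assms
proof (induction T' arbitrary: c)
  case (Cons C' Cs')
  have C': "C' \<noteq> []" "\<forall>x\<in>set C'. 0 < x" "sorted_wrt (>) C'" "dominates (set C') (first_column Cs')" "rssyt Cs'"
    using Cons.prems(1) by (simp_all add: rssyt_Cons)
  show ?case
  proof (cases c)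
    case 0
    have corner: "Cs' \<noteq> [] \<Longrightarrow> length (hd Cs') < length C'"
      using Cons.prems(3) 0 by (simp add: hd_conv_nth)
    have pos: "0 < last C'" using C' by simp
    have less: "\<forall>y\<in>set (butlast C'). last C' < y"
      using C'(3) append_butlast_last_id[OF C'(1)] sorted_wrt_append[of "(>)" "butlast C'" "[last C']"] by simp
    show ?thesis
    proof (cases "butlast C' = []")
      case True
      then have "column_insert (last C') [] = (C' # Cs', c)"
        using corner_Cons_butlast_empty[OF Cons.prems(1) corner] 0 by simp
      then show ?thesis using pos rssyt_Nil by blast
    next
      case False
      have "column_insert (last C') (butlast C' # Cs') = (C' # Cs', c)"
        using column_insert_append[OF less] C'(1) 0 by simp
      then show ?thesis using pos rssyt_butlast_Cons[OF Cons.prems(1) corner False] by blast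
    qed
  next
    case (Suc c0)
    have "c0 < length Cs'" "Suc c0 < length Cs' \<Longrightarrow> length (Cs' ! Suc c0) < length (Cs' ! c0)"
      using Cons.prems(2,3) Suc by simp_all
    from Cons.IH[OF C'(5) this] obtain y Cs where
      y: "0 < y" "rssyt Cs" "column_insert y Cs = (Cs', c0)" by blast
    have D': "first_column Cs' = insert_into_column (first_column Cs) y"
      using first_column_insert[OF y(2), of y] y(3) by simp
    then have "y \<in> first_column Cs'" by (simp add: insert_into_column_def)
    then have ex: "\<exists>z. z \<in> set C' \<and> y \<le> z" using dominatesD_ex[OF C'(4)] by auto
    \<comment> \<open>Reverse bumping: \<open>y\<close> re-enters this column and ejects the least
      entry at or above it.\<close>
    define x where "x = (LEAST z. z \<in> set C' \<and> y \<le> z)"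
    have x: "x \<in> set C'" "y \<le> x" using LeastI_ex[OF ex] by (simp_all add: x_def)
    have least: "x \<le> z" if "z \<in> set C'" "y \<le> z" for z using that unfolding x_def by (simp add: Least_le)
    define C where "C = map (\<lambda>z. if z = x then y else z) C'"
    have set_C: "set C = insert y (set C' - {x})" using x(1) by (auto simp: C_def)
    have sorted_C: "sorted_wrt (>) C"
      unfolding C_def sorted_wrt_map
      by (rule sorted_wrt_mono_rel[OF _ C'(3)]) (use least x in force)
    have F: "\<not> (\<forall>z\<in>set C. x < z)" using x(2) set_C by auto
    have y_eq: "bumped (set C) x = y"
    proof (rule antisym)
      show "y \<le> bumped (set C) x" using bumped(3)[OF _ F, of y] set_C x(2) by simp
      show "bumped (set C) x \<le> y"
        using bumped(1,2)[OF List.finite_set F] least[of "bumped (set C) x"] unfolding set_C by fastforce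
    qed
    have "bump C x = C'"
      unfolding bump_def y_eq unfolding C_def map_map o_def
      using least x by (intro map_idI) (auto dest: least)
    then have "column_insert x (C # Cs) = (C' # Cs', c)"
      using column_insert_bump[OF F] y_eq y(3) Suc by simp
    moreover have "dominates (set C) (first_column Cs)"
      unfolding set_C by (rule dominates_reverse_insert) (use C'(4) D' x least in auto)
    then have "rssyt (C # Cs)"
      using y sorted_C C'(1,2) by (auto simp: rssyt_Cons set_C) (simp add: C_def)
    moreover have "0 < x" using x C'(2) by blast
    ultimately show ?thesis by blast
  qed
qed simp

text \<open>This is why equal letters are recorded strictly from left to right.\<close>

lemma row_bump:
  assumes "rssyt T" "column_insert x T = (T', c)" "column_insert x' T' = (T'', c')"
  shows "c < c' \<longleftrightarrow> x \<le> x'"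
  using assms
proof (induction T arbitrary: x x' T' T'' c c')
  case Nil
  then have T': "T' = [[x]]" "c = 0" by simp_all
  show ?case
    using Nil.prems(3) column_insert_index_eq_0[of x' "[[x]]"] unfolding T' by (auto simp: not_le)
next
  case (Cons C Cs)
  show ?case
  proof (cases "\<forall>y\<in>set C. x < y")
    case True
    then have T': "T' = (C @ [x]) # Cs" "c = 0" using Cons.prems(2) by (simp_all add: column_insert_append)
    have "c' = 0 \<longleftrightarrow> (\<forall>y\<in>set (C @ [x]). x' < y)"
      using Cons.prems(3) column_insert_index_eq_0[of x' T'] unfolding T' by simp
    also have "\<dots> \<longleftrightarrow> x' < x" using True by auto
    finally show ?thesis using T'(2) by auto
  next
    case False
    let ?y = "bumped (set C) x"
    obtain Cs' c1 where r: "column_insert ?y Cs = (Cs', c1)" by fastforce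
    have T': "T' = bump C x # Cs'" "c = Suc c1"
      using Cons.prems(2) column_insert_bump[OF False] r by simp_all
    note b = bump_least[OF False] and bd = bumped[OF List.finite_set False]
    show ?thesis
    proof (cases "\<forall>y\<in>set (bump C x). x' < y")
      case True
      then have "c' = 0" using Cons.prems(3) T' by (simp add: column_insert_append)
      moreover have "x' < x" using True b(1) by blast
      ultimately show ?thesis by simp
    next
      case F: False
      let ?y' = "bumped (set (bump C x)) x'"
      note b' = bumped[OF List.finite_set F]
      have c': "c' = Suc (snd (column_insert ?y' Cs'))"
        using Cons.prems(3) column_insert_bump[OF F] T' by auto
      have "c1 < snd (column_insert ?y' Cs') \<longleftrightarrow> ?y \<le> ?y'"
        using Cons.prems(1) r
        by - (rule Cons.IH[OF _ r, of ?y' "fst (column_insert ?y' Cs')"], simp_all add: rssyt_Cons)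
      moreover have "?y \<le> ?y' \<longleftrightarrow> x \<le> x'"
      proof
        assume "x \<le> x'"
        then show "?y \<le> ?y'" using b'(3)[OF b(1)] b(2) by simp
      next
        assume "?y \<le> ?y'"
        then show "x \<le> x'" using b(3)[OF b'(1)] b'(2) by simp
      qed
      ultimately show ?thesis using c' T' by simp
    qed
  qed
qed


subsection \<open>The RSK correspondence\<close>

text \<open>Shapes list column lengths, so adding a box in column \<open>c\<close> increments entry \<open>c\<close>.\<close>

definition grow :: "nat \<Rightarrow> nat list \<Rightarrow> nat list" where
  "grow c s = (if c < length s then s[c := Suc (s ! c)] else s @ [1])"

text \<open>As the lengths are nonzero, entry \<open>c\<close> equals 1 after growth only when the
  column is new; this separates the two cases of \<open>grow\<close>.\<close>

lemma grow_inject: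
  assumes "grow c s = grow c s'" "c \<le> length s" "c \<le> length s'" "0 \<notin> set s" "0 \<notin> set s'"
  shows "s = s'"
proof -
  have at_end: "grow c s ! c = 1 \<longleftrightarrow> c = length s" if "c \<le> length s" "0 \<notin> set s" for s
  proof (cases "c < length s")
    case True
    then have "s ! c \<noteq> 0" using that(2) nth_mem by metis
    then show ?thesis using True by (simp add: grow_def)
  qed (use that in \<open>simp add: grow_def\<close>)
  show ?thesis
  proof (cases "c = length s")
    case True
    then have "c = length s'" using at_end assms by metis
    then show ?thesis using True assms(1) by (simp add: grow_def)
  next
    case False
    then have "c \<noteq> length s'" using at_end assms by metis
    then have l: "c < length s" "c < length s'" using False assms by auto
    then have e: "s[c := Suc (s ! c)] = s'[c := Suc (s' ! c)]" using assms(1) by (simp add: grow_def)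
    then have "Suc (s ! c) = Suc (s' ! c)" using l by (metis nth_list_update_eq)
    then show ?thesis using e by (metis list_update_id list_update_overwrite nat.inject)
  qed
qed

lemma shape_column_insert:
  assumes "column_insert x T = (T', c)"
  shows "c \<le> length T \<and> shape T' = grow c (shape T)"
  using assms
proof (induction T arbitrary: x T' c)
  case Nil
  then show ?case by (auto simp: shape_def grow_def)
next
  case (Cons C Cs)
  show ?case
  proof (cases "\<forall>y\<in>set C. x < y")
    case True
    then show ?thesis using Cons.prems by (auto simp: column_insert_append shape_def grow_def)
  next
    case False
    obtain Cs' c' where r: "column_insert (bumped (set C) x) Cs = (Cs', c')" by fastforce
    with Cons.prems False have "T' = bump C x # Cs'" "c = Suc c'" by (auto simp: column_insert_bump)
    then show ?thesis using Cons.IH[OF r] by (simp add: shape_def grow_def bump_def)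
  qed
qed

lemma shape_append_to_column: "c \<le> length Q \<Longrightarrow> shape (append_to_column c k Q) = grow c (shape Q)"
  by (auto simp: shape_def append_to_column_def grow_def map_update)

lemma append_to_column_Cons [simp]:
  "append_to_column 0 k (C # Cs) = (C @ [k]) # Cs"
  "append_to_column (Suc c) k (C # Cs) = C # append_to_column c k Cs"
  "append_to_column c k [] = [[k]]"
  by (auto simp: append_to_column_def)

lemma set_append_to_column:
  "c \<le> length Q \<Longrightarrow> \<Union>(set ` set (append_to_column c k Q)) = insert k (\<Union>(set ` set Q))"
proof (induction Q arbitrary: c)
  case (Cons C Cs)
  then show ?case by (cases c) auto
qed simp

lemma first_column_append_to_column:
  "c \<le> length Q \<Longrightarrow>
    first_column (append_to_column c k Q) = (if c = 0 then insert k (first_column Q) else first_column Q)"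
  by (cases Q; cases c) auto

text \<open>Counts at \<open>v > k\<close> are as before. At \<open>v <= k\<close> all entries are
  counted, since none is below \<open>k\<close>, and dominance reduces to the condition on column
  lengths.\<close>

lemma rssyt_append_to_column:
  assumes "rssyt Q" "c \<le> length Q" "sorted_wrt (\<ge>) (shape (append_to_column c k Q))" "0 < k"
    and "\<forall>C\<in>set Q. \<forall>e\<in>set C. k \<le> e" "k \<notin> set (column Q c)"
  shows "rssyt (append_to_column c k Q)"
  using assms
proof (induction Q arbitrary: c)
  case Nil
  then show ?case by (simp add: rssyt_Cons)
next
  case (Cons C Cs)
  have C: "C \<noteq> []" "\<forall>x\<in>set C. 0 < x" "sorted_wrt (>) C" "dominates (set C) (first_column Cs)" "rssyt Cs"
    using Cons.prems(1) by (simp_all add: rssyt_Cons)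
  show ?case
  proof (cases c)
    case 0
    have "\<forall>e\<in>set C. k < e"
      using Cons.prems(5,6) unfolding 0 by (auto simp: column_def order_le_less)
    moreover have "dominates (set (C @ [k])) (first_column Cs)"
      by (rule dominates_mono[OF C(4)]) auto
    ultimately show ?thesis using C Cons.prems(4) 0 by (auto simp: rssyt_Cons sorted_wrt_append)
  next
    case (Suc c0)
    let ?Cs = "append_to_column c0 k Cs"
    have c0: "c0 \<le> length Cs" using Cons.prems(2) Suc by simp
    have r: "rssyt ?Cs"
      using Cons.prems C Suc by (intro Cons.IH) (auto simp: column_def shape_def split: if_splits)
    have "dominates (set C) (first_column ?Cs)"
      unfolding dominates_def
    proof
      fix v
      show "card {b \<in> first_column ?Cs. v \<le> b} \<le> card {a \<in> set C. v \<le> a}"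
      proof (cases "v \<le> k")
        case True
        then have "{a \<in> set C. v \<le> a} = set C" using Cons.prems(5) by fastforce
        moreover have "card {b \<in> first_column ?Cs. v \<le> b} \<le> card (first_column ?Cs)"
          by (intro card_mono) auto
        moreover have "card (first_column ?Cs) \<le> length C"
        proof (cases ?Cs)
          case (Cons D Ds)
          then have "length D \<le> length C" using Cons.prems(3) Suc by (simp add: shape_def)
          then show ?thesis using card_length[of D] Cons by simp
        qed simp
        moreover have "distinct C" using distinct_column[OF Cons.prems(1), of 0] by (simp add: column_def)
        ultimately show ?thesis by (simp add: distinct_card)
      next
        case False
        then have "{b \<in> first_column ?Cs. v \<le> b} = {b \<in> first_column Cs. v \<le> b}"
          unfolding first_column_append_to_column[OF c0] by auto
        then show ?thesis using C(4) unfolding dominates_def by simp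
      qed
    qed
    then show ?thesis using r C Suc by (simp add: rssyt_Cons)
  qed
qed

lemma rssyt_remove_corner:
  assumes "rssyt T" "c < length T" "Suc c < length T \<Longrightarrow> length (T ! Suc c) < length (T ! c)"
  shows "\<exists>Q. rssyt Q \<and> c \<le> length Q \<and> append_to_column c (last (T ! c)) Q = T"
  using assms
proof (induction T arbitrary: c)
  case (Cons C Cs)
  have C: "C \<noteq> []" "\<forall>x\<in>set C. 0 < x" "sorted_wrt (>) C" "dominates (set C) (first_column Cs)" "rssyt Cs"
    using Cons.prems(1) by (simp_all add: rssyt_Cons)
  show ?case
  proof (cases c)
    case 0
    have corner: "Cs \<noteq> [] \<Longrightarrow> length (hd Cs) < length C"
      using Cons.prems(3) 0 by (simp add: hd_conv_nth)
    show ?thesis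
    proof (cases "butlast C = []")
      case True
      then show ?thesis
        using corner_Cons_butlast_empty[OF Cons.prems(1) corner] 0 by (intro exI[of _ "[]"]) simp
    next
      case False
      then show ?thesis
        using rssyt_butlast_Cons[OF Cons.prems(1) corner] C(1) 0
        by (intro exI[of _ "butlast C # Cs"]) simp
    qed
  next
    case (Suc c0)
    have "c0 < length Cs" "Suc c0 < length Cs \<Longrightarrow> length (Cs ! Suc c0) < length (Cs ! c0)"
      using Cons.prems(2,3) Suc by simp_all
    from Cons.IH[OF C(5) this] obtain Q where
      Q: "rssyt Q" "c0 \<le> length Q" "append_to_column c0 (last (Cs ! c0)) Q = Cs" by blast
    have "first_column Q \<subseteq> first_column Cs"
      using first_column_append_to_column[OF Q(2), of "last (Cs ! c0)"] Q(3) by (auto split: if_splits)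
    then have "dominates (set C) (first_column Q)" using dominates_mono[OF C(4) subset_refl] by simp
    then have "rssyt (C # Q)" using C Q(1) by (simp add: rssyt_Cons)
    then show ?thesis using Q Suc by (intro exI[of _ "C # Q"]) simp
  qed
qed simp

section \<open>The correspondence on lists of letter pairs\<close>

definition rsk_pairs :: "(nat \<times> nat) list \<Rightarrow> tableau \<times> tableau" where
  "rsk_pairs = foldl rsk_step ([], [])"

lemma rsk_pairs_Nil [simp]: "rsk_pairs [] = ([], [])"
  by (simp add: rsk_pairs_def)

lemma rsk_pairs_snoc:
  "rsk_pairs w = (P, Q) \<Longrightarrow> column_insert x P = (P', c) \<Longrightarrow>
    rsk_pairs (w @ [(x, k)]) = (P', append_to_column c k Q)"
  by (simp add: rsk_pairs_def rsk_step_def)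

definition knuth_pairs :: "(nat \<times> nat) list \<Rightarrow> bool" where
  "knuth_pairs w = knuth_biword (map fst w, map snd w)"

lemma knuth_pairs_Nil [simp]: "knuth_pairs []"
  by (simp add: knuth_pairs_def knuth_biword_def)

lemma knuth_pairs_snoc:
  "knuth_pairs (w @ [(x, k)]) \<longleftrightarrow> knuth_pairs w \<and> 0 < x \<and> 0 < k \<and> (\<forall>e \<in> snd ` set w. k \<le> e) \<and>
    (w \<noteq> [] \<longrightarrow> snd (last w) = k \<longrightarrow> fst (last w) \<le> x)"
proof -
  let ?p = "\<lambda>w. \<forall>j. Suc j < length w \<longrightarrow> snd (w ! j) = snd (w ! Suc j) \<longrightarrow> fst (w ! j) \<le> fst (w ! Suc j)"
  have kp: "knuth_pairs w \<longleftrightarrow> (\<forall>a\<in>set w. 0 < fst a \<and> 0 < snd a) \<and> sorted_wrt (\<ge>) (map snd w) \<and> ?p w" for w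
    by (auto simp: knuth_pairs_def knuth_biword_def)
  have "?p (w @ [(x, k)]) \<longleftrightarrow> ?p w \<and> (w \<noteq> [] \<longrightarrow> snd (last w) = k \<longrightarrow> fst (last w) \<le> x)"
  proof
    assume l: "?p (w @ [(x, k)])"
    have "?p w"
    proof (intro allI impI)
      fix j assume "Suc j < length w" "snd (w ! j) = snd (w ! Suc j)"
      then show "fst (w ! j) \<le> fst (w ! Suc j)" using l[rule_format, of j] by (simp add: nth_append)
    qed
    moreover have "fst (last w) \<le> x" if "w \<noteq> []" "snd (last w) = k"
      using l[rule_format, of "length w - 1"] that by (simp add: nth_append last_conv_nth)
    ultimately show "?p w \<and> (w \<noteq> [] \<longrightarrow> snd (last w) = k \<longrightarrow> fst (last w) \<le> x)" by blast
  next
    assume r: "?p w \<and> (w \<noteq> [] \<longrightarrow> snd (last w) = k \<longrightarrow> fst (last w) \<le> x)"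
    show "?p (w @ [(x, k)])"
    proof (intro allI impI)
      fix j
      assume j: "Suc j < length (w @ [(x, k)])"
        and e: "snd ((w @ [(x, k)]) ! j) = snd ((w @ [(x, k)]) ! Suc j)"
      show "fst ((w @ [(x, k)]) ! j) \<le> fst ((w @ [(x, k)]) ! Suc j)"
      proof (cases "Suc j < length w")
        case True
        then show ?thesis using r e by (simp add: nth_append)
      next
        case False
        then have l: "length w = Suc j" using j by simp
        then have "w \<noteq> []" by auto
        then have "last w = w ! j" using l by (simp add: last_conv_nth)
        then show ?thesis using r e l \<open>w \<noteq> []\<close> by (simp add: nth_append)
      qed
    qed
  qed
  then show ?thesis unfolding kp by (auto simp: sorted_wrt_append)
qed

lemma knuth_pairs_last_le:
  "knuth_pairs w \<Longrightarrow> e \<in> snd ` set w \<Longrightarrow> snd (last w) \<le> e"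
proof (induction w rule: rev_induct)
  case (snoc a w)
  then show ?case using knuth_pairs_snoc[of w "fst a" "snd a"] by auto
qed simp

lemma rssyt_rsk_pairs: "knuth_pairs w \<Longrightarrow> rssyt (fst (rsk_pairs w))"
proof (induction w rule: rev_induct)
  case (snoc a w)
  obtain P Q where PQ: "rsk_pairs w = (P, Q)" by fastforce
  obtain P' c where c: "column_insert (fst a) P = (P', c)" by fastforce
  have "rssyt P" "0 < fst a" using snoc PQ knuth_pairs_snoc[of w "fst a" "snd a"] by auto
  then have "rssyt P'" using rssyt_column_insert[of P "fst a"] c by simp
  then show ?case using rsk_pairs_snoc[OF PQ c, of "snd a"] by simp
qed simp

text \<open>For a nonempty Knuth word, the column of the last box created. In \<open>Q\<close> it is
  the rightmost column containing the last recorded letter, which is what makes the last step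
  reversible.\<close>

definition new_column :: "(nat \<times> nat) list \<Rightarrow> nat" where
  "new_column w = snd (column_insert (fst (last w)) (fst (rsk_pairs (butlast w))))"

lemma new_column_row_bump:
  assumes "knuth_pairs w" "w \<noteq> []" "rsk_pairs w = (P, Q)" "column_insert x P = (P', c)"
  shows "new_column w < c \<longleftrightarrow> fst (last w) \<le> x"
proof -
  obtain w0 x0 k0 where w: "w = w0 @ [(x0, k0)]" using assms(2) by (metis rev_exhaust surj_pair)
  obtain P0 Q0 where PQ: "rsk_pairs w0 = (P0, Q0)" by fastforce
  obtain P1 c0 where c: "column_insert x0 P0 = (P1, c0)" by fastforce
  have "P1 = P" using rsk_pairs_snoc[OF PQ c, of k0] assms(3) w by simp
  moreover have "rssyt P0" using rssyt_rsk_pairs[of w0] PQ assms(1) knuth_pairs_snoc[of w0 x0 k0] w by simp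
  ultimately show ?thesis
    using row_bump[of P0 x0 P c0 x P' c] c assms(4) w PQ by (simp add: new_column_def)
qed

text \<open>The clauses feed each other, hence a single induction: the last clause together with row
  bumping keeps \<open>k\<close> out of the columns from \<open>c\<close> on, which makes the new
  \<open>Q\<close> an RSSYT and supplies a hypothesis of \<open>key_columns_step\<close>.\<close>

lemma rsk_pairs_invariant:
  assumes "knuth_pairs w" "rsk_pairs w = (P, Q)"
  shows "rssyt P \<and> rssyt Q \<and> shape P = shape Q \<and> \<Union>(set ` set Q) = snd ` set w \<and>
    ((\<forall>j. dominates (right_key_column P j) (left_key_column Q j)) \<longleftrightarrow> (\<forall>a\<in>set w. snd a \<le> fst a)) \<and>
    (w \<noteq> [] \<longrightarrow> snd (last w) \<in> set (column Q (new_column w)) \<and>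
      (\<forall>j > new_column w. snd (last w) \<notin> set (column Q j)))"
  using assms
proof (induction w arbitrary: P Q rule: rev_induct)
  case Nil
  then show ?case
    using left_key_column_out[of "[]"] by (auto simp: shape_def)
next
  case (snoc a w)
  obtain x k where a: "a = (x, k)" by fastforce
  obtain P0 Q0 where PQ: "rsk_pairs w = (P0, Q0)" by fastforce
  obtain P' c where c: "column_insert x P0 = (P', c)" by fastforce
  have w: "knuth_pairs w" "0 < x" "0 < k" "\<forall>e \<in> snd ` set w. k \<le> e"
    "w \<noteq> [] \<Longrightarrow> snd (last w) = k \<Longrightarrow> fst (last w) \<le> x"
    using snoc.prems(1) unfolding a knuth_pairs_snoc by auto
  have P: "P = P'" and Q: "Q = append_to_column c k Q0"
    using rsk_pairs_snoc[OF PQ c, of k] snoc.prems(2) a by simp_all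
  have IH: "rssyt P0" "rssyt Q0" "shape P0 = shape Q0" "\<Union>(set ` set Q0) = snd ` set w"
    "(\<forall>j. dominates (right_key_column P0 j) (left_key_column Q0 j)) \<longleftrightarrow> (\<forall>a\<in>set w. snd a \<le> fst a)"
    "w \<noteq> [] \<Longrightarrow> \<forall>j > new_column w. snd (last w) \<notin> set (column Q0 j)"
    using snoc.IH[OF w(1) PQ] by blast+
  have "length P0 = length Q0" using IH(3) unfolding shape_def by (rule map_eq_imp_length_eq)
  then have cl: "c \<le> length Q0" and shP: "shape P' = grow c (shape Q0)"
    using shape_column_insert[OF c] IH(3) by auto
  have sh: "shape P' = shape Q" using shP shape_append_to_column[OF cl] Q by simp
  have rP: "rssyt P'" using rssyt_column_insert[OF IH(1) w(2)] c by simp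
  have k: "\<forall>C\<in>set Q0. \<forall>e\<in>set C. k \<le> e" using w(4) unfolding IH(4)[symmetric] by blast
  \<comment> \<open>If \<open>k\<close> occurs already, it is the previous recorded letter, so the
    Knuth condition orders the two inserted letters. Row bumping then puts the new box strictly
    right of every earlier \<open>k\<close>.\<close>
  have kc: "\<forall>j\<ge>c. k \<notin> set (column Q0 j)"
  proof (intro allI impI notI)
    fix j assume j: "c \<le> j" "k \<in> set (column Q0 j)"
    then have kw: "k \<in> snd ` set w" unfolding IH(4)[symmetric] by (auto simp: column_def split: if_splits)
    then have ne: "w \<noteq> []" by auto
    then have l: "snd (last w) = k"
      using knuth_pairs_last_le[OF w(1) kw] w(4) by (simp add: le_antisym)
    then have "new_column w < c" using new_column_row_bump[OF w(1) ne PQ c] w(5)[OF ne] by simp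
    then show False using IH(6)[OF ne] l j by simp
  qed
  have rQ: "rssyt Q"
    unfolding Q
  proof (rule rssyt_append_to_column[OF IH(2) cl _ w(3) k])
    show "sorted_wrt (\<ge>) (shape (append_to_column c k Q0))"
      using rP sh unfolding Q rssyt_def by simp
    show "k \<notin> set (column Q0 c)" using kc by simp
  qed
  have "(\<forall>j. dominates (right_key_column P' j) (left_key_column Q j)) \<longleftrightarrow> (\<forall>a\<in>set w. snd a \<le> fst a) \<and> k \<le> x"
    using key_columns_step[OF IH(1) rP c IH(2) rQ Q cl IH(3) sh k kc] IH(5) by simp
  moreover have "\<Union>(set ` set Q) = insert k (snd ` set w)"
    using set_append_to_column[OF cl, of k] IH(4) Q by simp
  moreover have "new_column (w @ [a]) = c" using PQ c a by (simp add: new_column_def)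
  moreover have "column Q j = (if j = c then column Q0 c @ [k] else column Q0 j)" for j
    unfolding Q by (rule column_append_to_column[OF cl])
  ultimately show ?case using rP rQ sh kc P a by auto
qed

lemma append_to_column_inject:
  assumes "append_to_column c k Q = append_to_column c k Q'" "c \<le> length Q" "c \<le> length Q'"
    and "[] \<notin> set Q" "[] \<notin> set Q'"
  shows "Q = Q'"
proof -
  have "shape Q = shape Q'"
  proof (rule grow_inject)
    show "grow c (shape Q) = grow c (shape Q')"
      using assms(1) shape_append_to_column assms(2,3) by metis
  qed (use assms in \<open>auto simp: shape_def\<close>)
  then have len: "length Q = length Q'" unfolding shape_def by (rule map_eq_imp_length_eq)
  have col: "column Q j = column Q' j" for j
    using column_append_to_column[OF assms(2), of k j] column_append_to_column[OF assms(3), of k j] assms(1)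
    by (auto split: if_splits)
  show ?thesis
  proof (rule nth_equalityI[OF len])
    show "Q ! i = Q' ! i" if "i < length Q" for i
      using col[of i] that len by (simp add: column_def)
  qed
qed

lemma rsk_pairs_inject:
  assumes "knuth_pairs w" "knuth_pairs w'" "rsk_pairs w = rsk_pairs w'"
  shows "w = w'"
  using assms
proof (induction w arbitrary: w' rule: rev_induct)
  case Nil
  obtain P Q where "rsk_pairs w' = (P, Q)" by fastforce
  then have "snd ` set w' = {}" using rsk_pairs_invariant[OF Nil.prems(2)] Nil.prems(3) by auto
  then show ?case by simp
next
  case (snoc a w)
  obtain P' Q' where PQ': "rsk_pairs (w @ [a]) = (P', Q')" "rsk_pairs w' = (P', Q')"
    using snoc.prems(3) by fastforce
  note inv = rsk_pairs_invariant[OF snoc.prems(1) PQ'(1)] and inv' = rsk_pairs_invariant[OF snoc.prems(2) PQ'(2)]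
  have "snd ` set w' \<noteq> {}" using inv inv' by auto
  then have ne: "w' \<noteq> []" by auto
  then obtain v b where w': "w' = v @ [b]" by (metis rev_exhaust)
  have "snd a \<in> snd ` set w'" "snd b \<in> snd ` set (w @ [a])" using inv inv' w' by auto
  then have k: "snd a = snd b"
    using knuth_pairs_last_le[OF snoc.prems(1), of "snd b"] knuth_pairs_last_le[OF snoc.prems(2), of "snd a"] w'
    by simp
  have inv1: "snd a \<in> set (column Q' (new_column (w @ [a])))"
    "\<forall>j > new_column (w @ [a]). snd a \<notin> set (column Q' j)" using inv by auto
  have inv2: "snd a \<in> set (column Q' (new_column w'))"
    "\<forall>j > new_column w'. snd a \<notin> set (column Q' j)" using inv' ne w' k by auto
  \<comment> \<open>Both words end in the same recorded letter, and \<open>Q'\<close> determines its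
    rightmost occurrence.\<close>
  have c: "new_column (w @ [a]) = new_column w'" using inv1 inv2 by (meson linorder_neqE_nat)
  obtain P Q where PQ: "rsk_pairs w = (P, Q)" by fastforce
  obtain P2 Q2 where PQ2: "rsk_pairs v = (P2, Q2)" by fastforce
  obtain P1 c where ins: "column_insert (fst a) P = (P1, c)" by fastforce
  obtain P3 c2 where ins2: "column_insert (fst b) P2 = (P3, c2)" by fastforce
  have "c2 = c" using c ins ins2 PQ PQ2 w' by (simp add: new_column_def)
  have eqs: "P1 = P'" "append_to_column c (snd a) Q = Q'"
    using rsk_pairs_snoc[OF PQ ins, of "snd a"] PQ'(1) by simp_all
  have eqs2: "P3 = P'" "append_to_column c (snd a) Q2 = Q'"
    using rsk_pairs_snoc[OF PQ2 ins2, of "snd b"] PQ'(2) w' k \<open>c2 = c\<close> by simp_all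
  have kw: "knuth_pairs w" "knuth_pairs v"
    using snoc.prems(1,2) w' knuth_pairs_snoc[of w "fst a" "snd a"] knuth_pairs_snoc[of v "fst b" "snd b"] by auto
  note i1 = rsk_pairs_invariant[OF kw(1) PQ] and i2 = rsk_pairs_invariant[OF kw(2) PQ2]
  have x: "fst a = fst b" "P = P2"
    using column_insert_inject[of P P2 "fst a" P' c "fst b"] i1 i2 ins ins2 eqs eqs2 \<open>c2 = c\<close> by auto
  have len: "length P = length Q" "length P2 = length Q2"
    using i1 i2 map_eq_imp_length_eq[of length P length Q] map_eq_imp_length_eq[of length P2 length Q2]
    by (auto simp: shape_def)
  have "Q = Q2"
  proof (rule append_to_column_inject)
    show "append_to_column c (snd a) Q = append_to_column c (snd a) Q2" using eqs eqs2 by simp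
    show "c \<le> length Q" "c \<le> length Q2"
      using shape_column_insert[OF ins] shape_column_insert[OF ins2] len \<open>c2 = c\<close> by auto
    show "[] \<notin> set Q" "[] \<notin> set Q2" using i1 i2 by (auto simp: rssyt_def)
  qed
  then have "w = v" using snoc.IH[OF kw] PQ PQ2 x by simp
  then show ?case using w' x k by (simp add: prod_eq_iff)
qed

lemma last_le_of_sorted: "sorted_wrt (>) C \<Longrightarrow> (x :: nat) \<in> set C \<Longrightarrow> last C \<le> x"
  by (induction C) (auto intro: less_imp_le)

text \<open>The step undone is the one at the rightmost column of \<open>Q\<close> containing its
  minimum; the number of boxes decreases.\<close>

lemma rsk_pairs_surj:
  assumes "rssyt P" "rssyt Q" "shape P = shape Q"
  shows "\<exists>w. knuth_pairs w \<and> rsk_pairs w = (P, Q)"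
  using assms
proof (induction "sum_list (shape Q)" arbitrary: P Q rule: less_induct)
  case less
  note P' = less.prems(1) and Q' = less.prems(2) and sh = less.prems(3)
  have len: "length P = length Q" using sh unfolding shape_def by (rule map_eq_imp_length_eq)
  show ?case
  proof (cases "Q = []")
    case True
    then show ?thesis using len by (intro exI[of _ "[]"]) simp
  next
    case False
    let ?E = "\<Union>(set ` set Q)"
    define k where "k = Min ?E"
    have fe: "finite ?E" by simp
    have ne: "?E \<noteq> {}" using False Q' by (cases Q) (auto simp: rssyt_Cons)
    have k: "k \<in> ?E" "\<And>e. e \<in> ?E \<Longrightarrow> k \<le> e"
      unfolding k_def by (rule Min_in[OF fe ne], rule Min_le[OF fe])
    let ?J = "{j. j < length Q \<and> k \<in> set (Q ! j)}"
    obtain C where "C \<in> set Q" "k \<in> set C" using k(1) by blast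
    then have J: "finite ?J" "?J \<noteq> {}" by (auto simp: in_set_conv_nth[of C])
    define c where "c = Max ?J"
    have c: "c < length Q" "k \<in> set (Q ! c)" and c_max: "\<And>j. j < length Q \<Longrightarrow> k \<in> set (Q ! j) \<Longrightarrow> j \<le> c"
      using Max_in[OF J] Max_ge[OF J(1)] unfolding c_def by auto
    have col: "Q ! j \<noteq> []" "sorted_wrt (>) (Q ! j)" if "j < length Q" for j
    proof -
      have "Q ! j \<in> set Q" using that by simp
      then show "Q ! j \<noteq> []" "sorted_wrt (>) (Q ! j)" using Q' unfolding rssyt_def by metis+
    qed
    have entry: "k \<le> e" if "j < length Q" "e \<in> set (Q ! j)" for e j
    proof -
      have "e \<in> ?E" using that nth_mem by blast
      then show ?thesis by (rule k(2))
    qed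
    have last: "last (Q ! c) = k"
    proof (rule antisym)
      show "last (Q ! c) \<le> k" using last_le_of_sorted[OF col(2)[OF c(1)] c(2)] .
      show "k \<le> last (Q ! c)" using entry[OF c(1) last_in_set[OF col(1)[OF c(1)]]] .
    qed
    \<comment> \<open>Were the next column as long, its entry beside the bottom of column
      \<open>c\<close> would be at most \<open>k\<close>, hence equal to \<open>k\<close>,
      contradicting the choice of \<open>c\<close>.\<close>
    have corner: "length (Q ! Suc c) < length (Q ! c)" if sc: "Suc c < length Q"
    proof (rule ccontr)
      assume n: "\<not> length (Q ! Suc c) < length (Q ! c)"
      define r where "r = length (Q ! c) - 1"
      have r: "r < length (Q ! Suc c)" using n col(1)[OF c(1)] unfolding r_def by (cases "Q ! c") auto
      then have "Q ! Suc c ! r \<le> Q ! c ! r" using Q' sc unfolding rssyt_def by blast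
      also have "\<dots> = k" using last col(1)[OF c(1)] unfolding r_def by (simp add: last_conv_nth)
      finally have "Q ! Suc c ! r = k"
        using entry[OF sc nth_mem[OF r]] by simp
      then have "Suc c \<le> c" using c_max[OF sc] r nth_mem by blast
      then show False by simp
    qed
    obtain Q0 where Q0: "rssyt Q0" "c \<le> length Q0" "append_to_column c k Q0 = Q"
      using rssyt_remove_corner[OF Q' c(1) corner] last by blast
    have cornerP: "length (P ! Suc c) < length (P ! c)" if "Suc c < length P"
      using corner that length_column_shape[OF sh, of c] length_column_shape[OF sh, of "Suc c"] len
      by (auto simp: column_def)
    obtain x P0 where P0: "0 < x" "rssyt P0" "column_insert x P0 = (P, c)"
      using column_insert_surj[OF P' _ cornerP] c(1) len by auto
    have sh0: "shape P0 = shape Q0"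
    proof (rule grow_inject)
      show "grow c (shape P0) = grow c (shape Q0)"
        using shape_column_insert[OF P0(3)] shape_append_to_column[OF Q0(2), of k] Q0(3) sh by simp
      show "c \<le> length (shape P0)" "c \<le> length (shape Q0)"
        using shape_column_insert[OF P0(3)] Q0(2) by (simp_all add: shape_def)
      show "0 \<notin> set (shape P0)" "0 \<notin> set (shape Q0)"
        using P0(2) Q0(1) by (auto simp: rssyt_def shape_def)
    qed
    have "sum_list (grow c s) = Suc (sum_list s)" for s
      by (simp add: grow_def sum_list_update member_le_sum_list)
    then have "sum_list (shape Q0) < sum_list (shape Q)"
      using shape_append_to_column[OF Q0(2), of k] Q0(3) by simp
    then obtain w where w: "knuth_pairs w" "rsk_pairs w = (P0, Q0)"
      using less.hyps[OF _ P0(2) Q0(1) sh0] by blast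
    note inv = rsk_pairs_invariant[OF w]
    have colQ: "column Q j = (if j = c then column Q0 c @ [k] else column Q0 j)" for j
      using column_append_to_column[OF Q0(2), of k j] Q0(3) by simp
    have E: "?E = insert k (snd ` set w)" using set_append_to_column[OF Q0(2), of k] Q0(3) inv by simp
    \<comment> \<open>The previous \<open>k\<close> lies in no column beyond \<open>c\<close> by
      maximality and not in \<open>c\<close> since columns are strict; row bumping then orders the
      letters.\<close>
    have "fst (last w) \<le> x" if ne: "w \<noteq> []" and l: "snd (last w) = k"
    proof -
      let ?c = "new_column w"
      have kc: "k \<in> set (column Q0 ?c)" using inv ne l by simp
      have "?c \<noteq> c"
      proof
        assume "?c = c"
        then have "\<not> distinct (column Q c)" using kc colQ[of c] by simp
        then show False using distinct_column[OF Q'] by blast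
      qed
      then have "k \<in> set (column Q ?c)" using kc colQ[of ?c] by simp
      then have "?c \<le> c" using c_max by (auto simp: column_def split: if_splits)
      then show ?thesis using new_column_row_bump[OF w(1) ne w(2) P0(3)] \<open>?c \<noteq> c\<close> by simp
    qed
    moreover have "0 < k" using k(1) Q' by (auto simp: rssyt_def)
    ultimately have "knuth_pairs (w @ [(x, k)])"
      using w(1) P0(1) k(2) E unfolding knuth_pairs_snoc by auto
    moreover have "rsk_pairs (w @ [(x, k)]) = (P, Q)"
      using rsk_pairs_snoc[OF w(2) P0(3), of k] Q0(3) by simp
    ultimately show ?thesis by blast
  qed
qed

theorem theorem1p13:
  "bij_betw rsk bounded_knuth_biwords key_bounded_pairs"
proof -
  let ?S = "{w. knuth_pairs w \<and> (\<forall>a\<in>set w. snd a \<le> fst a)}"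
  let ?f = "\<lambda>w. (map fst w, map snd w)"
  have rsk: "rsk (?f w) = rsk_pairs w" for w
    by (simp add: rsk_def rsk_pairs_def zip_map_fst_snd)
  have B: "bounded_knuth_biwords = ?f ` ?S"
  proof (intro set_eqI iffI)
    fix ai assume "ai \<in> bounded_knuth_biwords"
    then obtain a i where ai: "ai = (a, i)" "knuth_biword (a, i)" "bounded_biword (a, i)"
      by (cases ai) (auto simp: bounded_knuth_biwords_def)
    then have l: "length a = length i" by (simp add: knuth_biword_def)
    then have "ai = ?f (zip a i)" "zip a i \<in> ?S"
      using ai by (auto simp: knuth_pairs_def bounded_biword_def in_set_zip)
    then show "ai \<in> ?f ` ?S" by blast
  next
    fix ai assume "ai \<in> ?f ` ?S"
    then show "ai \<in> bounded_knuth_biwords"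
      by (auto simp: bounded_knuth_biwords_def knuth_pairs_def bounded_biword_def)
  qed
  \<comment> \<open>Being an equivalence, this gives both that bounded words map into the
    key-bounded pairs and that preimages of key-bounded pairs are bounded.\<close>
  have key: "rsk_pairs w \<in> key_bounded_pairs \<longleftrightarrow> (\<forall>a\<in>set w. snd a \<le> fst a)" if w: "knuth_pairs w" for w
  proof -
    obtain P Q where PQ: "rsk_pairs w = (P, Q)" by fastforce
    then show ?thesis
      using rsk_pairs_invariant[OF w PQ] tableau_ge_keys_iff[of P Q] by (auto simp: key_bounded_pairs_def)
  qed
  have "inj_on rsk_pairs ?S" using rsk_pairs_inject by (auto intro: inj_onI)
  then have "inj_on rsk (?f ` ?S)" by (auto simp: inj_on_def rsk)
  moreover have "rsk ` ?f ` ?S = key_bounded_pairs"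
  proof (intro set_eqI iffI)
    fix PQ assume "PQ \<in> rsk ` ?f ` ?S"
    then show "PQ \<in> key_bounded_pairs" using key by (auto simp: rsk)
  next
    fix PQ assume PQ: "PQ \<in> key_bounded_pairs"
    then obtain w where "knuth_pairs w" "rsk_pairs w = PQ"
      using rsk_pairs_surj by (cases PQ) (auto simp: key_bounded_pairs_def)
    then show "PQ \<in> rsk ` ?f ` ?S" using key PQ by (auto simp: rsk image_image intro!: image_eqI[of _ _ w])
  qed
  ultimately show ?thesis unfolding B by (simp add: bij_betw_def)
qed

end
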